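(* Let $\alpha = (1+\sqrt{17})/2$ and $\beta = (1-\sqrt{17})/2$ be the roots of $x^2-x-4=0$. Define integer sequences $\{V_j\}_{j\ge 0}$ and $\{W_j\}_{j\ge 0}$ by $$V_0=2,\quad V_1=1,\quad V_{j+1}=V_j+4V_{j-1}\ (j\ge 1),$$ $$W_0=0,\quad W_1=1,\quad W_{j+1}=W_j+4W_{j-1}\ (j\ge 1);$$ equivalently, $V_j=\alpha^j+\beta^j$ and $W_j=(\alpha^j-\beta^j)/\sqrt{17}$ for all $j\ge 0$. Let $BT_k$ be the binary-tree graphs and let $\mathrm{Ham}(BT_k)$ denote the number of oriented Hamiltonian paths of $BT_k$. Then for all $k\ge 1$, $$\mathrm{Ham}(BT_k)=\tfrac{3}{16}\bigl(17\,V_{2k}+71\,W_{2k}\bigr)-\tfrac{9}{2}\cdot 4^k.$$ Equivalently, with $P=(867+213\sqrt{17})/272$ and $Q=(867-213\sqrt{17})/272$, for all $k\ge 1$, $$\mathrm{Ham}(BT_k)=P\,\alpha^{2k}+Q\,\beta^{2k}-\tfrac{9}{2}\cdot 4^k.$$ Moreover, the number of vertices of $BT_k$ is $n=3\cdot 2^k-2$, so that, with $\theta=\log_2(\alpha^2)=2\log_2\alpha\approx 2.714$, the leading term $P\,\alpha^{2k}$ grows as $\Theta(n^{\theta})$ as $k\to\infty$.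
   Context: Graphs are finite, simple and undirected. A Hamiltonian path of a graph $G$ is a simple path visiting every vertex of $G$ exactly once. $\mathrm{Ham}(G)$ denotes the number of oriented Hamiltonian paths of $G$: a Hamiltonian path and its reversal are counted separately (thus $\mathrm{Ham}(K_m)=m!$ for $m\ge 2$), i.e. $\mathrm{Ham}(G)$ counts orderings $(v_1,\dots,v_m)$ of all vertices of $G$ in which consecutive vertices are adjacent. Auxiliary graphs $BT'_k$ ($k\ge 1$), each with one distinguished vertex called the root port and two distinguished vertices called the leaf ports: $BT'_1:=K_3$, with one vertex designated the root port and the other two the leaf ports. For $k\ge 2$, $BT'_k$ is formed from two disjoint copies $D,E$ of $BT'_{k-1}$ and one new vertex $q$ by adding three edges: $q$ to the root port of $D$, $q$ to the root port of $E$, and one edge between a leaf port of $D$ and a leaf port of $E$. The remaining (unconnected) leaf port of $D$ and the remaining leaf port of $E$ become the leaf ports of $BT'_k$, and $q$ becomes its root port. Equivalently, $BT'_k$ is the complete binary tree of depth $k$ (with $2^{k+1}-1$ vertices) in which all $2^k$ leaves are additionally joined left-to-right by a path; the tree root is the root port and the two endpoints of the leaf-path are the leaf ports. Binary-tree graphs $BT_k$ ($k\ge 1$): $BT_1:=K_4$. For $k\ge 2$, $BT_k$ is formed from three disjoint copies of $BT'_{k-1}$, one new center vertex $c$, and six new edges: three edges joining $c$ to the root port of each copy, and three edges forming a perfect matching on the six leaf ports (two per copy) in which every leaf port is matched to a leaf port of a different copy. (Such a matching necessarily has exactly one edge between each pair of copies, so $BT_k$ is well defined up to isomorphism.) *)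

theory Defs
  imports
    "Graph_Theory.Graph_Theory"
    "HOL-Library.Disjoint_Sets"
    "HOL-Library.Landau_Symbols"
    Complex_Main
begin

text \<open>
  A simple undirected graph is, as in the library, a symmetric loop-free digraph without
  parallel arcs, so an undirected edge is a pair of opposite arcs.
\<close>

definition Ham :: "('a, 'b) pre_digraph \<Rightarrow> nat" where
  "Ham G = card {p. vpath p G \<and> set p = verts G}"

text \<open>
  \<open>BT' k G r a b\<close>: the graph \<open>G\<close> is a copy of $BT'_k$ with root port \<open>r\<close> and leaf ports
  \<open>a\<close> and \<open>b\<close>. The relation is invariant under relabelling the vertices and under exchanging
  the two leaf ports (see \<open>BT'_swap\<close> below), so that \<open>b\<close> and \<open>a'\<close> in the second rule are an
  arbitrary leaf port of \<open>D\<close> and an arbitrary leaf port of \<open>E\<close>.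
\<close>

inductive BT' :: "nat \<Rightarrow> 'a pair_pre_digraph \<Rightarrow> 'a \<Rightarrow> 'a \<Rightarrow> 'a \<Rightarrow> bool" where
  base: "complete_digraph 3 (with_proj G) \<Longrightarrow> pverts G = {r, a, b} \<Longrightarrow> BT' 1 G r a b"
| step: "BT' k D r a b \<Longrightarrow> BT' k E r' a' b' \<Longrightarrow> pverts D \<inter> pverts E = {} \<Longrightarrow>
    q \<notin> pverts D \<union> pverts E \<Longrightarrow>
    BT' (Suc k)
      \<lparr> pverts = insert q (pverts D \<union> pverts E),
        parcs = parcs D \<union> parcs E \<union> {(q, r), (r, q), (q, r'), (r', q), (b, a'), (a', b)} \<rparr>
      q a b'"

text \<open>
  \<open>BT k G\<close>: the graph \<open>G\<close> is a copy of $BT_k$. The matching on the leaf ports is a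
  partition \<open>M\<close> of the six ports into edges \<open>{u, v}\<close>.
\<close>

inductive BT :: "nat \<Rightarrow> 'a pair_pre_digraph \<Rightarrow> bool" where
  base: "complete_digraph 4 (with_proj G) \<Longrightarrow> BT 1 G"
| step: "(\<And>i. i < (3::nat) \<Longrightarrow> BT' k (D i) (r i) (a i) (b i)) \<Longrightarrow>
    disjoint_family_on (\<lambda>i. pverts (D i)) {..<3} \<Longrightarrow>
    c \<notin> (\<Union>i<3. pverts (D i)) \<Longrightarrow>
    partition_on (\<Union>i<3. {a i, b i}) M \<Longrightarrow>
    (\<And>e. e \<in> M \<Longrightarrow>
      \<exists>i<3. \<exists>j<3. i \<noteq> j \<and> (\<exists>u\<in>{a i, b i}. \<exists>v\<in>{a j, b j}. e = {u, v})) \<Longrightarrow>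
    BT (Suc k)
      \<lparr> pverts = insert c (\<Union>i<3. pverts (D i)),
        parcs = (\<Union>i<3. parcs (D i)) \<union> (\<Union>i<3. {(c, r i), (r i, c)}) \<union> {(u, v). {u, v} \<in> M} \<rparr>"

text \<open>
  Sanity checks: \<open>BT'\<close> is symmetric in the leaf ports, the described graphs are
  simple, finite and undirected, and they exist on every infinite type.
\<close>

lemma BT'_swap: "BT' k G r a b \<Longrightarrow> BT' k G r b a"
proof (induction rule: BT'.induct)
  case (base G r a b)
  then show ?case by (intro BT'.base) auto
next
  case (step k D r a b E r' a' b' q)
  have "BT' (Suc k)
      \<lparr> pverts = insert q (pverts E \<union> pverts D),
        parcs = parcs E \<union> parcs D \<union> {(q, r'), (r', q), (q, r), (r, q), (a', b), (b, a')} \<rparr>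
      q b' a"
    by (rule BT'.step) (use step in auto)
  then show ?case
    by (simp add: Un_commute insert_commute)
qed

lemma pair_graph_iff:
  "pair_graph G \<longleftrightarrow> finite (pverts G) \<and> parcs G \<subseteq> pverts G \<times> pverts G \<and> sym (parcs G) \<and> irrefl (parcs G)"
proof
  assume "pair_graph G"
  then interpret pair_graph G .
  show "finite (pverts G) \<and> parcs G \<subseteq> pverts G \<times> pverts G \<and> sym (parcs G) \<and> irrefl (parcs G)"
    using pair_finite_verts pair_sym_arcs
    by (auto simp: symmetric_def irrefl_def dest: in_arcsD1 in_arcsD2 pair_no_loops)
next
  assume *: "finite (pverts G) \<and> parcs G \<subseteq> pverts G \<times> pverts G \<and> sym (parcs G) \<and> irrefl (parcs G)"
  then have "finite (parcs G)" by (meson finite_SigmaI finite_subset)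
  with * show "pair_graph G"
    by unfold_locales (auto simp: symmetric_def irrefl_def)
qed

lemma BT'_ports:
  assumes "BT' k G r a b"
  shows "pair_graph G \<and> r \<in> pverts G \<and> a \<in> pverts G \<and> b \<in> pverts G
    \<and> r \<noteq> a \<and> r \<noteq> b \<and> a \<noteq> b"
  using assms
proof (induction rule: BT'.induct)
  case (base G r a b)
  then have "card {r, a, b} = 3" by (simp add: complete_digraph_def)
  then have "r \<noteq> a \<and> r \<noteq> b \<and> a \<noteq> b"
    by (auto simp: card_insert_if split: if_splits)
  with base show ?case by (auto intro: pair_graphI_complete)
next
  case (step k D r a b E r' a' b' q)
  from step have wf: "finite (pverts D)" "finite (pverts E)"
    "parcs D \<subseteq> pverts D \<times> pverts D" "parcs E \<subseteq> pverts E \<times> pverts E"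
    "sym (parcs D)" "sym (parcs E)" "irrefl (parcs D)" "irrefl (parcs E)"
    and ports: "r \<in> pverts D" "a \<in> pverts D" "b \<in> pverts D"
      "r' \<in> pverts E" "a' \<in> pverts E" "b' \<in> pverts E"
    by (simp_all add: pair_graph_iff)
  define S where "S = {(q, r), (r, q), (q, r'), (r', q), (b, a'), (a', b)}"
  have neq: "q \<noteq> r" "q \<noteq> r'" "b \<noteq> a'" "q \<noteq> a" "q \<noteq> b'" "a \<noteq> b'"
    using ports step(3,4) by auto
  have "sym S" "irrefl S" "S \<subseteq> insert q (pverts D \<union> pverts E) \<times> insert q (pverts D \<union> pverts E)"
    using neq ports by (auto simp: S_def sym_def irrefl_def)
  with wf have "pair_graph \<lparr> pverts = insert q (pverts D \<union> pverts E), parcs = parcs D \<union> parcs E \<union> S \<rparr>"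
    unfolding pair_graph_iff by (auto intro!: sym_Un simp: irrefl_def)
  then show ?case
    using ports neq by (simp add: S_def)
qed

lemma BT_pair_graph:
  assumes "BT k G"
  shows "pair_graph G"
  using assms
proof cases
  case base
  then show ?thesis by (auto intro: pair_graphI_complete)
next
  case (step k D r a b c M)
  have D: "pair_graph (D i)" "r i \<in> pverts (D i)" "a i \<in> pverts (D i)" "b i \<in> pverts (D i)"
    if "i < 3" for i
    using BT'_ports[OF step(3)[OF that]] by auto
  have M: "u \<noteq> v \<and> u \<in> (\<Union>i<3. pverts (D i)) \<and> v \<in> (\<Union>i<3. pverts (D i))"
    if "{u, v} \<in> M" for u v
  proof -
    from step(7)[OF that] obtain i j x y where *: "i < 3" "j < 3" "i \<noteq> j"
      "x \<in> {a i, b i}" "y \<in> {a j, b j}" "{u, v} = {x, y}" by blast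
    then have "x \<in> pverts (D i)" "y \<in> pverts (D j)" using D by auto
    moreover from this have "x \<noteq> y"
      using step(4) * by (auto simp: disjoint_family_on_def)
    ultimately show ?thesis using * by (auto simp: doubleton_eq_iff)
  qed
  have Di: "finite (pverts (D i))" "\<And>u v. (u, v) \<in> parcs (D i) \<Longrightarrow>
      u \<in> pverts (D i) \<and> v \<in> pverts (D i) \<and> (v, u) \<in> parcs (D i) \<and> u \<noteq> v"
    if "i < 3" for i
    using D(1)[OF that] unfolding pair_graph_iff irrefl_def sym_def by blast+
  have arc: "u \<in> pverts G \<and> v \<in> pverts G \<and> (v, u) \<in> parcs G \<and> u \<noteq> v"
    if "(u, v) \<in> parcs G" for u v
  proof -
    from that consider i where "i < 3" "(u, v) \<in> parcs (D i)"
      | i where "i < 3" "(u = c \<and> v = r i) \<or> (u = r i \<and> v = c)" | "{u, v} \<in> M"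
      by (auto simp: step(2))
    then show ?thesis
    proof cases
      case (1 i)
      then show ?thesis using Di(2)[of i u v] by (auto simp: step(2))
    next
      case (2 i)
      with D(2)[of i] step(5) have "r i \<noteq> c" by auto
      with 2 D(2)[of i] show ?thesis by (auto simp: step(2))
    next
      case 3
      with M[OF 3] show ?thesis by (simp add: step(2) insert_commute)
    qed
  qed
  moreover have "finite (pverts G)" using Di(1) by (simp add: step(2))
  ultimately show ?thesis
    unfolding pair_graph_iff irrefl_def sym_def by (auto dest: arc)
qed

lemma ex_complete_pair_digraph:
  assumes "card A = n" "finite A"
  shows "complete_digraph n (with_proj \<lparr> pverts = A, parcs = {(u, v). u \<in> A \<and> v \<in> A \<and> u \<noteq> v} \<rparr>)"
  using assms by (auto simp: complete_digraph_pair_def)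

lemma ex_BT':
  fixes F :: "'a set"
  assumes inf: "infinite (UNIV :: 'a set)" and "k \<ge> 1" and "finite F"
  shows "\<exists>G r a b. BT' k G r a b \<and> pverts G \<inter> F = {}"
  using assms(2,3)
proof (induction k arbitrary: F rule: dec_induct)
  case base
  have "infinite (- F)" using inf base by (simp add: Compl_eq_Diff_UNIV)
  then obtain A where A: "A \<subseteq> - F" "finite A" "card A = 3"
    by (meson infinite_arbitrarily_large)
  then obtain r a b where "A = {r, a, b}" by (auto simp: card_3_iff)
  with BT'.base[OF ex_complete_pair_digraph[OF A(3,2)]] A(1) show ?case by fastforce
next
  case (step k)
  from step.IH[OF step.prems] obtain D r a b
    where D: "BT' k D r a b" "pverts D \<inter> F = {}" by blast
  have fD: "finite (pverts D)" using BT'_ports[OF D(1)] by (simp add: pair_graph_iff)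
  with step.IH[of "F \<union> pverts D"] step.prems obtain E r' a' b'
    where E: "BT' k E r' a' b'" "pverts E \<inter> (F \<union> pverts D) = {}" by blast
  have fE: "finite (pverts E)" using BT'_ports[OF E(1)] by (simp add: pair_graph_iff)
  obtain q where q: "q \<notin> F \<union> pverts D \<union> pverts E"
    using ex_new_if_finite[OF inf] fD fE step.prems by (metis finite_UnI)
  have "pverts D \<inter> pverts E = {}" "q \<notin> pverts D \<union> pverts E" using E q by auto
  from BT'.step[OF D(1) E(1) this] show ?case
    using D(2) E(2) q
    by (intro exI conjI) (assumption, auto)
qed

lemma ex_BT:
  assumes inf: "infinite (UNIV :: 'a set)" and "k \<ge> 1"
  shows "\<exists>G :: 'a pair_pre_digraph. BT k G"
proof (cases "k = 1")
  case True
  obtain A :: "'a set" where A: "finite A" "card A = 4"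
    using infinite_arbitrarily_large[OF inf] by blast
  with BT.base[OF ex_complete_pair_digraph[OF A(2,1)]] True show ?thesis by blast
next
  case False
  define m where "m = k - 1"
  have m: "m \<ge> 1" "k = Suc m" using False assms(2) by (auto simp: m_def)
  have fin: "finite (pverts D)" if "BT' m D r a b" for D :: "'a pair_pre_digraph" and r a b
    using BT'_ports[OF that] by (simp add: pair_graph_iff)
  obtain D0 :: "'a pair_pre_digraph" and r0 a0 b0 where D0: "BT' m D0 r0 a0 b0"
    using ex_BT'[OF inf m(1), of "{}"] by blast
  obtain D1 r1 a1 b1 where D1: "BT' m D1 r1 a1 b1" "pverts D1 \<inter> pverts D0 = {}"
    using ex_BT'[OF inf m(1) fin[OF D0]] by blast
  obtain D2 r2 a2 b2 where D2: "BT' m D2 r2 a2 b2" "pverts D2 \<inter> (pverts D0 \<union> pverts D1) = {}"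
    using ex_BT'[OF inf m(1), of "pverts D0 \<union> pverts D1"] fin[OF D0] fin[OF D1(1)] by blast
  obtain c where c: "c \<notin> pverts D0 \<union> pverts D1 \<union> pverts D2"
    using ex_new_if_finite[OF inf] fin[OF D0] fin[OF D1(1)] fin[OF D2(1)] by (metis finite_UnI)
  let ?s = "\<lambda>x y z (i::nat). if i = 0 then x else if i = 1 then y else z"
  let ?M = "{{b0, a1}, {b1, a2}, {b2, a0}}"
  have three: "{..<3} = {0, 1, 2 :: nat}" by auto
  have less3: "i = 0 \<or> i = 1 \<or> i = 2" if "i < 3" for i :: nat using that by auto
  have ports: "a0 \<in> pverts D0" "b0 \<in> pverts D0" "a1 \<in> pverts D1" "b1 \<in> pverts D1"
    "a2 \<in> pverts D2" "b2 \<in> pverts D2" "a0 \<noteq> b0" "a1 \<noteq> b1" "a2 \<noteq> b2"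
    using BT'_ports[OF D0] BT'_ports[OF D1(1)] BT'_ports[OF D2(1)] by auto
  have "BT (Suc m)
      \<lparr> pverts = insert c (\<Union>i<3. pverts (?s D0 D1 D2 i)),
        parcs = (\<Union>i<3. parcs (?s D0 D1 D2 i)) \<union> (\<Union>i<3. {(c, ?s r0 r1 r2 i), (?s r0 r1 r2 i, c)})
          \<union> {(u, v). {u, v} \<in> ?M} \<rparr>"
  proof (rule BT.step[where a = "?s a0 a1 a2" and b = "?s b0 b1 b2"])
    show "BT' m (?s D0 D1 D2 i) (?s r0 r1 r2 i) (?s a0 a1 a2 i) (?s b0 b1 b2 i)" if "i < 3" for i
      using D0 D1 D2 by simp
    show "disjoint_family_on (\<lambda>i. pverts (?s D0 D1 D2 i)) {..<3}"
      using D1(2) D2(2) by (auto simp: disjoint_family_on_def three)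
    show "c \<notin> (\<Union>i<3. pverts (?s D0 D1 D2 i))" using c by (auto simp: three)
    have "disjnt {b0, a1} {b1, a2}" "disjnt {b0, a1} {b2, a0}" "disjnt {b1, a2} {b2, a0}"
      using ports D1(2) D2(2) unfolding disjnt_def by blast+
    then show "partition_on (\<Union>i<3. {?s a0 a1 a2 i, ?s b0 b1 b2 i}) ?M"
      by (intro partition_onI) (auto simp: three disjnt_sym)
    fix e assume "e \<in> ?M"
    then consider "e = {b0, a1}" | "e = {b1, a2}" | "e = {b2, a0}" by blast
    then show "\<exists>i<3. \<exists>j<3. i \<noteq> j \<and> (\<exists>u\<in>{?s a0 a1 a2 i, ?s b0 b1 b2 i}.
        \<exists>v\<in>{?s a0 a1 a2 j, ?s b0 b1 b2 j}. e = {u, v})"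
    proof cases
      case 1 then show ?thesis by (intro exI[of _ 0] exI[of _ 1] conjI) auto
    next
      case 2 then show ?thesis by (intro exI[of _ 1] exI[of _ 2] conjI) auto
    next
      case 3 then show ?thesis by (intro exI[of _ 2] exI[of _ 0] conjI) auto
    qed
  qed
  then show ?thesis using m(2) by blast
qed

end

theory Submission
  imports Defs "HOL-Combinatorics.Multiset_Permutations"
begin

text \<open>
  A gadget $BT'_k$ touches the rest of the graph only through its three ports, and each port has a
  single edge leaving the gadget. A Hamiltonian path therefore cuts a gadget into very few pieces,
  and all that matters about the pieces is which ports they end at: each end of a piece is either a
  port, where the path leaves the gadget, or a free end of the whole Hamiltonian path. So the
  counts are kept for \<^emph>\<open>path systems\<close>: \<open>covers V E \<sigma>\<close> is the number of sequences of vertex-disjoint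
  paths that together cover \<open>V\<close>, where the \<open>i\<close>-th entry of \<open>\<sigma>\<close> prescribes the two ends of the \<open>i\<close>-th
  path, \<open>None\<close> standing for a free end. The number of oriented Hamiltonian paths is the value at
  \<open>[(None, None)]\<close>.

  Two rules compute these numbers for glued graphs. Adding an edge \<open>uv\<close> (\<open>covers_add_edge\<close>): a
  system that uses the new edge uses it once, in one path and one direction, and cutting there
  gives a system of the old graph with one more path and two more prescribed ends \<open>u\<close>, \<open>v\<close>.
  Disjoint unions (\<open>covers_Un_disjoint\<close>): if every path has a prescribed end, that end decides in
  which part the path lies, and the count is a product. With them every count of a glued graph
  becomes a finite sum that rewriting evaluates: \<open>routes\<close> lists the cut systems, most of which
  contribute zero.

  For $BT'_k$ six numbers suffice (\<open>profile\<close>); a path through the whole gadget between two given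
  ports is always unique. \<open>profile_step\<close> gives their recursion, and \<open>ring_counts\<close> with \<open>hub_count\<close>
  expresses $\mathrm{Ham}(BT_{k+1})$ by the six numbers for $BT'_k$. In the numbers
  \<open>er\<close>, \<open>ea\<close>, \<open>sa\<close> the recursion is linear with an inhomogeneity of order $2^k$; its characteristic
  polynomial is $(x-1)(x^2-x-4)$, which is where $\alpha$ and $\beta$ come from, and products of two
  such counts produce $\alpha^{2k}$; \<open>BT'_profile\<close> verifies the resulting closed forms by
  induction.
\<close>

section \<open>Path systems with prescribed ends\<close>

definition paths :: "'a set \<Rightarrow> ('a \<times> 'a) set \<Rightarrow> 'a option \<Rightarrow> 'a option \<Rightarrow> 'a list set" where
  "paths V E A B = {p. p \<noteq> [] \<and> distinct p \<and> set p \<subseteq> V \<and> successively (\<lambda>x y. (x, y) \<in> E) p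
     \<and> A \<in> {None, Some (hd p)} \<and> B \<in> {None, Some (last p)}}"

text \<open>
  The recursion takes the first path out of the vertex set and leaves the rest to the remaining
  paths. This makes every proof below an induction on the list of prescribed ends.
\<close>

fun covers :: "'a set \<Rightarrow> ('a \<times> 'a) set \<Rightarrow> ('a option \<times> 'a option) list \<Rightarrow> nat" where
  "covers V E [] = (if V = {} then 1 else 0)"
| "covers V E ((A, B) # \<sigma>) = (\<Sum>p\<in>paths V E A B. covers (V - set p) E \<sigma>)"

definition touches :: "'a set \<Rightarrow> 'a option \<times> 'a option \<Rightarrow> bool" where
  "touches W c \<longleftrightarrow> set_option (fst c) \<inter> W \<noteq> {} \<or> set_option (snd c) \<inter> W \<noteq> {}"

lemma touches_Un: "touches (V \<union> W) c \<longleftrightarrow> touches V c \<or> touches W c"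
  by (auto simp: touches_def)

lemma touches_end: "x \<in> W \<Longrightarrow> touches W (A, Some x)" "x \<in> W \<Longrightarrow> touches W (Some x, B)"
  by (auto simp: touches_def)

lemma touches_simps [simp]:
  "touches W (None, None) \<longleftrightarrow> False"
  "touches W (Some x, None) \<longleftrightarrow> x \<in> W"
  "touches W (None, Some y) \<longleftrightarrow> y \<in> W"
  "touches W (Some x, Some y) \<longleftrightarrow> x \<in> W \<or> y \<in> W"
  by (auto simp: touches_def)

lemma finite_paths: "finite V \<Longrightarrow> finite (paths V E A B)"
  by (rule finite_subset[OF _ finite_subset_distinct[of V]]) (auto simp: paths_def)

lemma rev_in_paths: "sym E \<Longrightarrow> p \<in> paths V E A B \<Longrightarrow> rev p \<in> paths V E B A"
  by (auto simp: paths_def hd_rev last_rev sym_def elim!: successively_mono)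

lemma covers_rev:
  assumes "sym E"
  shows "covers V E ((A, B) # \<sigma>) = covers V E ((B, A) # \<sigma>)"
  unfolding covers.simps
  by (rule sum.reindex_bij_witness[of _ rev rev]) (auto intro: rev_in_paths assms)

lemma paths_diff: "p \<in> paths (V - S) E A B \<longleftrightarrow> p \<in> paths V E A B \<and> set p \<inter> S = {}"
  by (auto simp: paths_def)

text \<open>
  The order of the paths and the orientation of each path (\<open>covers_rev\<close>) are immaterial, so a few
  representative counts determine all of them.
\<close>

lemma covers_swap:
  assumes "finite V"
  shows "covers V E (c # d # \<sigma>) = covers V E (d # c # \<sigma>)"
proof -
  obtain A B C D where cd: "c = (A, B)" "d = (C, D)" by fastforce
  let ?f = "\<lambda>p q. covers (V - set p - set q) E \<sigma>"
  have split: "covers V E ((A, B) # (C, D) # \<sigma>) =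
     (\<Sum>p\<in>paths V E A B. \<Sum>q\<in>paths V E C D. if set p \<inter> set q = {} then ?f p q else 0)"
    for A B C D
    unfolding covers.simps using assms
    by (intro sum.cong[OF refl] sum.mono_neutral_cong_left) (auto simp: finite_paths paths_diff)
  show ?thesis
    unfolding cd split
    by (subst sum.swap) (auto intro!: sum.cong simp: Diff_eq Int_ac)
qed

text \<open>
  A path cannot end outside the vertex set. In the inductions this also kills the systems in which
  a vertex used up by an earlier path is an end of a later one.
\<close>

lemma covers_end_outside: "c \<in> set \<sigma> \<Longrightarrow> touches (- V) c \<Longrightarrow> covers V E \<sigma> = 0"
proof (induction \<sigma> arbitrary: V)
  case (Cons d \<sigma>)
  obtain A B where d: "d = (A, B)" by fastforce
  show ?case
  proof (cases "d = c")
    case True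
    have "hd p \<in> V" "last p \<in> V" if "p \<in> paths V E A B" for p
      using that hd_in_set[of p] last_in_set[of p] by (auto simp: paths_def)
    then have "A = None \<or> the A \<in> V" "B = None \<or> the B \<in> V" if "p \<in> paths V E A B" for p
      using that by (auto simp: paths_def)
    then have "paths V E A B = {}"
      using Cons.prems True by (force simp: d touches_def)
    then show ?thesis by (simp add: d)
  next
    case False
    then have "c \<in> set \<sigma>" using Cons.prems by simp
    moreover have "touches (- (V - set p)) c" for p :: "'a list"
      using Cons.prems by (auto simp: touches_def)
    ultimately show ?thesis using Cons.IH by (simp add: d)
  qed
qed simp

section \<open>Adding an edge\<close>

text \<open>
  All ways to cut one path of the system at an arc from \<open>u\<close> to \<open>v\<close>.
\<close>

fun splits :: "'a \<Rightarrow> 'a \<Rightarrow> ('a option \<times> 'a option) list \<Rightarrow> ('a option \<times> 'a option) list list" where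
  "splits u v [] = []"
| "splits u v ((A, B) # \<sigma>) = ((A, Some u) # (Some v, B) # \<sigma>) # map ((#) (A, B)) (splits u v \<sigma>)"

lemma splits_touch: "\<tau> \<in> set (splits u v \<sigma>) \<Longrightarrow> \<exists>c\<in>set \<tau>. touches {u} c"
  by (induction u v \<sigma> arbitrary: \<tau> rule: splits.induct) (auto simp: touches_def)

text \<open>
  The paths that run through the arc from \<open>u\<close> to \<open>v\<close>, glued from their two halves.
\<close>

definition joins :: "'a set \<Rightarrow> ('a \<times> 'a) set \<Rightarrow> 'a option \<Rightarrow> 'a option \<Rightarrow> 'a \<Rightarrow> 'a \<Rightarrow> 'a list set" where
  "joins V E A B u v = (\<lambda>(p, q). p @ q) `
     (SIGMA p : paths V E A (Some u). paths (V - set p) E (Some v) B)"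

lemma successively_cut:
  assumes "successively R' p" "\<not> successively R p"
  obtains p1 u v p2 where "p = p1 @ u # v # p2" "R' u v" "\<not> R u v"
proof -
  have "\<exists>p1 u v p2. p = p1 @ u # v # p2 \<and> R' u v \<and> \<not> R u v"
    using assms
  proof (induction p rule: induct_list012)
    case (3 x y zs)
    show ?case
    proof (cases "R x y")
      case True
      with 3 obtain p1 u v p2 where "y # zs = p1 @ u # v # p2 \<and> R' u v \<and> \<not> R u v" by auto
      then show ?thesis by (intro exI[of _ "x # p1"]) auto
    next
      case False
      with 3 show ?thesis by (intro exI[of _ "[]"]) auto
    qed
  qed auto
  then show thesis using that by blast
qed

text \<open>
  A path has distinct vertices, so it visits \<open>u\<close> and \<open>v\<close> once each. It can use the new edge in one
  direction only, and neither half uses it again.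
\<close>

lemma paths_add_edge:
  assumes "(u, v) \<notin> E" "(v, u) \<notin> E" "u \<noteq> v"
  shows "paths V (insert (u, v) (insert (v, u) E)) A B
           = paths V E A B \<union> (joins V E A B u v \<union> joins V E A B v u)"
    and "paths V E A B \<inter> (joins V E A B u v \<union> joins V E A B v u) = {}"
    and "joins V E A B u v \<inter> joins V E A B v u = {}"
proof -
  let ?E = "insert (u, v) (insert (v, u) E)"
  let ?R = "\<lambda>E x y. (x, y) \<in> E"
  have joins: "p \<in> joins V E A B x y \<longleftrightarrow> (\<exists>p1 p2. p = p1 @ x # y # p2 \<and> distinct p \<and> set p \<subseteq> V
      \<and> successively (?R E) (p1 @ [x]) \<and> successively (?R E) (y # p2)
      \<and> A \<in> {None, Some (hd p)} \<and> B \<in> {None, Some (last p)})" (is "?l = ?r") for p x y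
  proof
    assume ?l
    then obtain q1 q2 where q: "p = q1 @ q2" "q1 \<in> paths V E A (Some x)"
      "q2 \<in> paths (V - set q1) E (Some y) B" by (auto simp: joins_def)
    then have "q1 = butlast q1 @ [x]" "q2 = y # tl q2" by (auto simp: paths_def)
    with q show ?r by (intro exI[of _ "butlast q1"] exI[of _ "tl q2"]) (auto simp: paths_def)
  next
    assume ?r
    then obtain p1 p2 where p: "p = p1 @ x # y # p2" "distinct p" "set p \<subseteq> V"
      "successively (?R E) (p1 @ [x])" "successively (?R E) (y # p2)"
      "A \<in> {None, Some (hd p)}" "B \<in> {None, Some (last p)}" by blast
    then have "p1 @ [x] \<in> paths V E A (Some x)" "y # p2 \<in> paths (V - set (p1 @ [x])) E (Some y) B"
      by (auto simp: paths_def hd_append split: if_splits)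
    moreover have "p = (\<lambda>(p, q). p @ q) (p1 @ [x], y # p2)" using p by simp
    ultimately show ?l unfolding joins_def by blast
  qed
  have pure: "successively (?R E) p" if "successively (?R ?E) p" "u \<notin> set p \<or> v \<notin> set p" for p
    using that(1) by (rule successively_mono) (use that in auto)
  show "paths V ?E A B = paths V E A B \<union> (joins V E A B u v \<union> joins V E A B v u)" (is "?L = ?M")
  proof (intro equalityI subsetI)
    fix p assume p: "p \<in> ?L"
    show "p \<in> ?M"
    proof (cases "successively (?R E) p")
      case True
      with p show ?thesis by (auto simp: paths_def)
    next
      case False
      have "successively (?R ?E) p" using p by (simp add: paths_def)
      from successively_cut[OF this False] obtain p1 x y p2
        where c: "p = p1 @ x # y # p2" "(x, y) \<in> ?E" "(x, y) \<notin> E" by metis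
      have xy: "(x = u \<and> y = v) \<or> (x = v \<and> y = u)" using c by auto
      have "distinct p" "successively (?R ?E) p" using p by (auto simp: paths_def)
      then have "successively (?R E) (p1 @ [x])" "successively (?R E) (y # p2)"
        using xy by (auto simp: c(1) successively_append_iff intro!: pure)
      then have "p \<in> joins V E A B x y"
        using p c(1) unfolding joins by (auto simp: paths_def)
      with xy show ?thesis by auto
    qed
  next
    fix p assume "p \<in> ?M"
    moreover have "successively (?R ?E) p" if "successively (?R E) p" for p
      using that by (rule successively_mono) auto
    ultimately show "p \<in> ?L"
      by (auto simp: joins successively_append_iff paths_def successively_Cons)
  qed
  show "paths V E A B \<inter> (joins V E A B u v \<union> joins V E A B v u) = {}"
  proof (rule equals0I)
    fix p assume "p \<in> paths V E A B \<inter> (joins V E A B u v \<union> joins V E A B v u)"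
    then have "successively (?R E) p" "\<exists>p1 p2. p = p1 @ u # v # p2 \<or> p = p1 @ v # u # p2"
      unfolding Int_iff Un_iff joins by (auto simp: paths_def)
    with assms show False by (auto simp: successively_append_iff)
  qed
  show "joins V E A B u v \<inter> joins V E A B v u = {}"
  proof (rule equals0I)
    fix p assume "p \<in> joins V E A B u v \<inter> joins V E A B v u"
    then obtain p1 p2 q1 q2 where "distinct p" and p: "p = p1 @ u # v # p2" "p = q1 @ v # u # q2"
      unfolding Int_iff joins by blast
    moreover from this have "(q1 @ [v]) @ u # q2 = p1 @ u # v # p2" by simp
    moreover have "u \<notin> set (q1 @ [v])" "u \<notin> set q2" using \<open>distinct p\<close> unfolding p(2) by auto
    ultimately have "q1 @ [v] = p1" by (subst (asm) append_Cons_eq_iff) auto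
    with p(1) \<open>distinct p\<close> show False by auto
  qed
qed

lemma sum_joins:
  assumes "finite V"
  shows "(\<Sum>p\<in>joins V E A B u v. covers (V - set p) E \<sigma>)
      = covers V E ((A, Some u) # (Some v, B) # \<sigma>)"
proof -
  have inj: "inj_on (\<lambda>(p, q). p @ q) (SIGMA p : paths V E A (Some u). paths (V - set p) E (Some v) B)"
  proof (rule inj_onI, clarify)
    fix p q p' q'
    assume *: "p \<in> paths V E A (Some u)" "q \<in> paths (V - set p) E (Some v) B"
       "p' \<in> paths V E A (Some u)" "q' \<in> paths (V - set p') E (Some v) B" "p @ q = p' @ q'"
    have cut: "\<exists>r. p = r @ [u] \<and> u \<notin> set r \<and> u \<notin> set q"
      if "p \<in> paths V E A (Some u)" "q \<in> paths (V - set p) E (Some v) B" for p q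
      using that by (cases p rule: rev_cases) (auto simp: paths_def)
    obtain r where r: "p = r @ [u]" "u \<notin> set r" "u \<notin> set q" using cut[OF *(1,2)] by blast
    obtain r' where r': "p' = r' @ [u]" "u \<notin> set r'" "u \<notin> set q'" using cut[OF *(3,4)] by blast
    have "r @ u # q = r' @ u # q'" using *(5) r r' by simp
    then show "p = p' \<and> q = q'"
      using r r' by (subst (asm) append_Cons_eq_iff) auto
  qed
  have "V - set (p @ q) = V - set p - set q" for p q :: "'a list" by auto
  then show ?thesis
    unfolding joins_def
    by (subst sum.reindex[OF inj]) (simp add: assms finite_paths sum.Sigma split_def del: set_append)
qed

lemma sum_sum_list: "(\<Sum>x\<in>S. \<Sum>y\<leftarrow>ys. f x y) = (\<Sum>y\<leftarrow>ys. \<Sum>x\<in>S. f x y :: nat)"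
  by (induction ys) (auto simp: sum.distrib)

text \<open>
  A system either avoids the new edge or uses it in exactly one of its paths. In the induction the
  first path may use the edge, and then it contains \<open>u\<close> and \<open>v\<close>, so that the terms of the induction
  hypothesis that cut a later path at the edge vanish.
\<close>

lemma covers_add_edge:
  assumes "finite V" "(u, v) \<notin> E" "(v, u) \<notin> E" "u \<noteq> v"
  shows "covers V (insert (u, v) (insert (v, u) E)) \<sigma> =
    covers V E \<sigma> + (\<Sum>\<tau>\<leftarrow>splits u v \<sigma> @ splits v u \<sigma>. covers V E \<tau>)"
  using assms(1)
proof (induction \<sigma> arbitrary: V)
  case (Cons c \<sigma>)
  obtain A B where c: "c = (A, B)" by fastforce
  let ?E = "insert (u, v) (insert (v, u) E)"
  let ?S = "\<lambda>V. (\<Sum>\<tau>\<leftarrow>splits u v \<sigma> @ splits v u \<sigma>. covers V E \<tau>)"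
  let ?J = "joins V E A B"
  have fin: "finite (paths V E A B)" "finite (?J u v)" "finite (?J v u)"
    using Cons.prems by (auto simp: joins_def finite_paths)
  have IH: "covers (V - set p) ?E \<sigma> = covers (V - set p) E \<sigma> + ?S (V - set p)" for p
    using Cons by simp
  have zero: "?S (V - set p) = 0" if "p \<in> ?J u v \<union> ?J v u" for p
  proof -
    have "u \<in> set p" "v \<in> set p" using that by (auto simp: joins_def paths_def)
    then have touch: "touches (- (V - set p)) c" if "touches {u} c \<or> touches {v} c" for c
      using that by (auto simp: touches_def)
    have "covers (V - set p) E \<tau> = 0" if "\<tau> \<in> set (splits u v \<sigma> @ splits v u \<sigma>)" for \<tau>
    proof -
      from that obtain c where "c \<in> set \<tau>" "touches {u} c \<or> touches {v} c"
        using splits_touch by fastforce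
      then show ?thesis by (rule covers_end_outside[OF _ touch])
    qed
    then show ?thesis by (subst sum_list_eq_0_iff) auto
  qed
  have "covers V ?E (c # \<sigma>) = (\<Sum>p\<in>paths V ?E A B. covers (V - set p) E \<sigma> + ?S (V - set p))"
    by (simp only: c covers.simps IH)
  also have "\<dots> = (\<Sum>p\<in>paths V E A B. covers (V - set p) E \<sigma> + ?S (V - set p))
     + ((\<Sum>p\<in>?J u v. covers (V - set p) E \<sigma> + ?S (V - set p))
     + (\<Sum>p\<in>?J v u. covers (V - set p) E \<sigma> + ?S (V - set p)))"
    using paths_add_edge[OF assms(2-4), of V A B] fin by (simp add: sum.union_disjoint)
  also have "(\<Sum>p\<in>?J u v. covers (V - set p) E \<sigma> + ?S (V - set p))
      = (\<Sum>p\<in>?J u v. covers (V - set p) E \<sigma>)"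
    by (intro sum.cong refl) (use zero in simp)
  also have "(\<Sum>p\<in>?J v u. covers (V - set p) E \<sigma> + ?S (V - set p))
      = (\<Sum>p\<in>?J v u. covers (V - set p) E \<sigma>)"
    by (intro sum.cong refl) (use zero in simp)
  finally have "covers V ?E (c # \<sigma>) = (\<Sum>p\<in>paths V E A B. covers (V - set p) E \<sigma> + ?S (V - set p))
     + (covers V E ((A, Some u) # (Some v, B) # \<sigma>) + covers V E ((A, Some v) # (Some u, B) # \<sigma>))"
    unfolding sum_joins[OF Cons.prems] .
  moreover have "(\<Sum>p\<in>paths V E A B. covers (V - set p) E \<sigma> + ?S (V - set p))
     = covers V E (c # \<sigma>) + (\<Sum>\<tau>\<leftarrow>splits u v \<sigma> @ splits v u \<sigma>. covers V E (c # \<tau>))"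
    by (simp only: c covers.simps sum.distrib sum_sum_list)
  ultimately show ?case
    by (simp add: c o_def del: covers.simps)
qed (use assms in simp)


text \<open>
  The systems that remain after cutting at some of several new edges, one for each choice of the
  edges used, of their order along the paths, and of their directions.
\<close>

fun routes :: "('a \<times> 'a) list \<Rightarrow> ('a option \<times> 'a option) list \<Rightarrow> ('a option \<times> 'a option) list list" where
  "routes [] \<sigma> = [\<sigma>]"
| "routes ((u, v) # es) \<sigma> = concat (map (routes es) (\<sigma> # splits u v \<sigma> @ splits v u \<sigma>))"

fun arcs_of :: "('a \<times> 'a) list \<Rightarrow> ('a \<times> 'a) set" where
  "arcs_of [] = {}"
| "arcs_of ((u, v) # es) = insert (u, v) (insert (v, u) (arcs_of es))"

fun new_edges :: "('a \<times> 'a) list \<Rightarrow> ('a \<times> 'a) set \<Rightarrow> bool" where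
  "new_edges [] E \<longleftrightarrow> True"
| "new_edges ((u, v) # es) E \<longleftrightarrow>
     u \<noteq> v \<and> (u, v) \<notin> arcs_of es \<union> E \<and> (v, u) \<notin> arcs_of es \<union> E \<and> new_edges es E"

lemma sum_list_map_concat: "(\<Sum>x\<leftarrow>concat xss. f x) = (\<Sum>xs\<leftarrow>xss. \<Sum>x\<leftarrow>xs. f x)"
  by (induction xss) auto

lemma covers_add_edges:
  "finite V \<Longrightarrow> new_edges es E \<Longrightarrow>
    covers V (arcs_of es \<union> E) \<sigma> = (\<Sum>\<tau>\<leftarrow>routes es \<sigma>. covers V E \<tau>)"
proof (induction es arbitrary: \<sigma>)
  case (Cons e es)
  obtain u v where e: "e = (u, v)" by fastforce
  have "covers V (arcs_of es \<union> E) = (\<lambda>\<sigma>. \<Sum>\<tau>\<leftarrow>routes es \<sigma>. covers V E \<tau>)"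
    using Cons by (auto simp: e)
  then show ?case
    using Cons.prems covers_add_edge[of V u v "arcs_of es \<union> E" \<sigma>]
    by (simp add: e o_def sum_list_map_concat)
qed simp

section \<open>Disjoint unions\<close>

text \<open>
  A path with a prescribed end in \<open>W\<close> is called anchored here. Cutting keeps systems anchored,
  because each half ends at the cut.
\<close>

lemma splits_anchored:
  "\<tau> \<in> set (splits u v \<sigma>) \<Longrightarrow> \<forall>c\<in>set \<sigma>. touches W c \<Longrightarrow> u \<in> W \<Longrightarrow> v \<in> W \<Longrightarrow> \<forall>c\<in>set \<tau>. touches W c"
  by (induction u v \<sigma> arbitrary: \<tau> rule: splits.induct) (auto simp: touches_end)

lemma routes_anchored:
  "\<tau> \<in> set (routes es \<sigma>) \<Longrightarrow> \<forall>c\<in>set \<sigma>. touches W c \<Longrightarrow> set es \<subseteq> W \<times> W \<Longrightarrow> \<forall>c\<in>set \<tau>. touches W c"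
proof (induction es \<sigma> arbitrary: \<tau> rule: routes.induct)
  case (2 u v es \<sigma>)
  from 2(2) obtain \<sigma>' where s: "\<sigma>' \<in> set (\<sigma> # splits u v \<sigma> @ splits v u \<sigma>)" "\<tau> \<in> set (routes es \<sigma>')"
    by auto
  have "\<forall>c\<in>set \<sigma>'. touches W c"
    using s(1) 2(3,4) splits_anchored[of \<sigma>' u v \<sigma> W] splits_anchored[of \<sigma>' v u \<sigma> W] by auto
  with 2(1)[OF s] 2(4) show ?case by simp
qed simp

lemma successively_Un_disjoint:
  assumes "E1 \<subseteq> W1 \<times> W1" "E2 \<subseteq> W2 \<times> W2" "W1 \<inter> W2 = {}"
    and "successively (\<lambda>x y. (x, y) \<in> E1 \<union> E2) p" "set p \<subseteq> W1 \<union> W2"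
  shows "set p \<subseteq> W1 \<and> successively (\<lambda>x y. (x, y) \<in> E1) p
       \<or> set p \<subseteq> W2 \<and> successively (\<lambda>x y. (x, y) \<in> E2) p"
  using assms(4,5) by (induction p rule: induct_list012) (use assms(1-3) in auto)

lemma paths_Un_disjoint:
  assumes "E1 \<subseteq> W1 \<times> W1" "E2 \<subseteq> W2 \<times> W2" "W1 \<inter> W2 = {}" "V1 \<subseteq> W1" "V2 \<subseteq> W2"
    and "touches W1 (A, B)"
  shows "paths (V1 \<union> V2) (E1 \<union> E2) A B = paths V1 E1 A B"
proof (intro equalityI subsetI)
  fix p assume p: "p \<in> paths (V1 \<union> V2) (E1 \<union> E2) A B"
  then have "p \<noteq> []" "successively (\<lambda>x y. (x, y) \<in> E1 \<union> E2) p" "set p \<subseteq> W1 \<union> W2"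
    using assms(4,5) by (auto simp: paths_def)
  moreover have "\<not> set p \<subseteq> W2"
  proof
    assume "set p \<subseteq> W2"
    then have "hd p \<in> W2" "last p \<in> W2" using \<open>p \<noteq> []\<close> by auto
    then show False using p assms(3,6) by (auto simp: paths_def touches_def)
  qed
  ultimately have "set p \<subseteq> W1" "successively (\<lambda>x y. (x, y) \<in> E1) p"
    using successively_Un_disjoint[OF assms(1-3)] by blast+
  with p assms(3,5) show "p \<in> paths V1 E1 A B" by (auto simp: paths_def)
next
  fix p assume "p \<in> paths V1 E1 A B"
  then show "p \<in> paths (V1 \<union> V2) (E1 \<union> E2) A B"
    by (auto simp: paths_def elim: successively_mono)
qed

text \<open>
  The vertex sets shrink along the induction while the edges stay, so the edges are confined to
  fixed sets \<open>W1\<close> and \<open>W2\<close>, and these also decide to which part a path belongs. A path with prescribed ends in both parts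
  is assigned to the first one, where its count is zero, as it should be.
\<close>

lemma covers_Un_disjoint_within:
  assumes "E1 \<subseteq> W1 \<times> W1" "E2 \<subseteq> W2 \<times> W2" "W1 \<inter> W2 = {}" "V1 \<subseteq> W1" "V2 \<subseteq> W2"
    and "\<forall>c\<in>set \<sigma>. touches (W1 \<union> W2) c"
  shows "covers (V1 \<union> V2) (E1 \<union> E2) \<sigma> =
    covers V1 E1 (filter (touches W1) \<sigma>) * covers V2 E2 (filter (\<lambda>c. \<not> touches W1 c) \<sigma>)"
  using assms(4-)
proof (induction \<sigma> arbitrary: V1 V2)
  case (Cons c \<sigma>)
  obtain A B where c: "c = (A, B)" by fastforce
  have disj: "V1 \<inter> V2 = {}" using Cons.prems assms(3) by auto
  show ?case
  proof (cases "touches W1 c")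
    case True
    have "covers (V1 \<union> V2 - set p) (E1 \<union> E2) \<sigma> =
        covers (V1 - set p) E1 (filter (touches W1) \<sigma>) * covers V2 E2 (filter (\<lambda>c. \<not> touches W1 c) \<sigma>)"
      if "p \<in> paths V1 E1 A B" for p
    proof -
      have "V1 \<union> V2 - set p = (V1 - set p) \<union> V2" using that disj by (auto simp: paths_def)
      then show ?thesis using Cons.IH[of "V1 - set p" V2] Cons.prems by auto
    qed
    then show ?thesis
      using True paths_Un_disjoint[OF assms(1-3) Cons.prems(1,2), of A B]
      by (simp add: c sum_distrib_right)
  next
    case False
    then have "touches W2 (A, B)" using Cons.prems by (auto simp: touches_def c)
    then have paths: "paths (V1 \<union> V2) (E1 \<union> E2) A B = paths V2 E2 A B"
      using paths_Un_disjoint[OF assms(2,1) _ Cons.prems(2,1), of A B] assms(3)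
      by (simp add: Un_commute Int_commute)
    have "covers (V1 \<union> V2 - set p) (E1 \<union> E2) \<sigma> =
        covers V1 E1 (filter (touches W1) \<sigma>) * covers (V2 - set p) E2 (filter (\<lambda>c. \<not> touches W1 c) \<sigma>)"
      if "p \<in> paths V2 E2 A B" for p
    proof -
      have "V1 \<union> V2 - set p = V1 \<union> (V2 - set p)" using that disj by (auto simp: paths_def)
      then show ?thesis using Cons.IH[of V1 "V2 - set p"] Cons.prems by auto
    qed
    then show ?thesis
      using False paths by (simp add: c sum_distrib_left)
  qed
qed simp

lemmas covers_Un_disjoint = covers_Un_disjoint_within[OF _ _ _ order.refl order.refl]

lemma covers_disconnected:
  assumes "E1 \<subseteq> V1 \<times> V1" "E2 \<subseteq> V2 \<times> V2" "V1 \<inter> V2 = {}" "V1 \<noteq> {}" "V2 \<noteq> {}"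
  shows "covers (V1 \<union> V2) (E1 \<union> E2) [(A, B)] = 0"
proof -
  have "V1 \<union> V2 - set p \<noteq> {}" if "p \<in> paths (V1 \<union> V2) (E1 \<union> E2) A B" for p
    using successively_Un_disjoint[OF assms(1-3), of p] that assms(3-5)
    by (fastforce simp: paths_def)
  then show ?thesis by (auto intro!: sum.neutral)
qed

lemma covers_empty [simp]: "covers {} E \<sigma> = (if \<sigma> = [] then 1 else 0)"
  by (cases \<sigma>) (auto simp: paths_def)

lemma paths_single:
  "paths {q} {} A B = (if A \<in> {None, Some q} \<and> B \<in> {None, Some q} then {[q]} else {})"
proof -
  have "p = [q]" if "p \<in> paths {q} {} A B" for p
    using that by (cases p) (auto simp: paths_def subset_singleton_iff)
  then have "p \<in> paths {q} {} A B \<longleftrightarrow> p = [q] \<and> [q] \<in> paths {q} {} A B" for p by auto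
  then show ?thesis by (auto simp: paths_def)
qed

lemma covers_single:
  "covers {q} {} ((A, B) # \<sigma>) =
     (if A \<in> {None, Some q} \<and> B \<in> {None, Some q} \<and> \<sigma> = [] then 1 else 0)"
  by (simp add: paths_single)

lemma covers_rev2:
  assumes "sym E" "finite V"
  shows "covers V E [c, (A, B)] = covers V E [c, (B, A)]"
  using covers_swap[OF assms(2), of E c _ "[]"] covers_rev[OF assms(1), of V A B "[c]"] by simp

lemma covers_free:
  assumes "finite V"
  shows "covers V E [(None, None)] = card {p \<in> paths V E None None. set p = V}"
proof -
  have "{p \<in> paths V E None None. V \<subseteq> set p} = {p \<in> paths V E None None. set p = V}"
    by (auto simp: paths_def)
  then show ?thesis
    using finite_paths[OF assms] by (simp add: sum.If_cases Int_def)
qed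

lemma vwalk_arcs_subset_iff: "set (vwalk_arcs p) \<subseteq> E \<longleftrightarrow> successively (\<lambda>x y. (x, y) \<in> E) p"
  by (induction p rule: induct_list012) auto

lemma Ham_eq_covers:
  assumes "pair_graph G" "pverts G \<noteq> {}"
  shows "Ham (with_proj G) = covers (pverts G) (parcs G) [(None, None)]"
proof -
  have "{p. vpath p (with_proj G) \<and> set p = pverts G}
      = {p \<in> paths (pverts G) (parcs G) None None. set p = pverts G}"
    using assms(2) by (auto simp: vpath_def vwalk_def paths_def vwalk_arcs_subset_iff arcs_ends_conv)
  then show ?thesis using assms(1) by (simp add: Ham_def covers_free pair_graph_iff del: covers.simps)
qed

section \<open>Gluing three parts\<close>

text \<open>
  Every graph in the construction is glued from at most three parts and a hub: $K_3$ from three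
  vertices, $BT'_{k+1}$ from a vertex and two gadgets, and $BT_{k+1}$ without its center from three
  gadgets.
\<close>

declare covers.simps(2) [simp del]

lemma covers_three_parts:
  assumes wf: "finite V\<^sub>1" "finite V\<^sub>2" "finite V\<^sub>3"
      "E\<^sub>1 \<subseteq> V\<^sub>1 \<times> V\<^sub>1" "E\<^sub>2 \<subseteq> V\<^sub>2 \<times> V\<^sub>2" "E\<^sub>3 \<subseteq> V\<^sub>3 \<times> V\<^sub>3"
    and disj: "V\<^sub>1 \<inter> V\<^sub>2 = {}" "V\<^sub>1 \<inter> V\<^sub>3 = {}" "V\<^sub>2 \<inter> V\<^sub>3 = {}"
    and es: "new_edges es (E\<^sub>1 \<union> E\<^sub>2 \<union> E\<^sub>3)" "set es \<subseteq> (V\<^sub>1 \<union> V\<^sub>2 \<union> V\<^sub>3) \<times> (V\<^sub>1 \<union> V\<^sub>2 \<union> V\<^sub>3)"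
    and \<sigma>: "\<forall>c\<in>set \<sigma>. touches (V\<^sub>1 \<union> V\<^sub>2 \<union> V\<^sub>3) c"
  shows "covers (V\<^sub>1 \<union> V\<^sub>2 \<union> V\<^sub>3) (arcs_of es \<union> (E\<^sub>1 \<union> E\<^sub>2 \<union> E\<^sub>3)) \<sigma> =
    (\<Sum>\<tau>\<leftarrow>routes es \<sigma>.
       covers V\<^sub>1 E\<^sub>1 (filter (touches V\<^sub>1) \<tau>) *
       covers V\<^sub>2 E\<^sub>2 (filter (touches V\<^sub>2) (filter (\<lambda>c. \<not> touches V\<^sub>1 c) \<tau>)) *
       covers V\<^sub>3 E\<^sub>3 (filter (\<lambda>c. \<not> touches V\<^sub>2 c) (filter (\<lambda>c. \<not> touches V\<^sub>1 c) \<tau>)))"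
proof -
  have "covers (V\<^sub>1 \<union> V\<^sub>2 \<union> V\<^sub>3) (E\<^sub>1 \<union> E\<^sub>2 \<union> E\<^sub>3) \<tau> =
       covers V\<^sub>1 E\<^sub>1 (filter (touches V\<^sub>1) \<tau>) *
       covers V\<^sub>2 E\<^sub>2 (filter (touches V\<^sub>2) (filter (\<lambda>c. \<not> touches V\<^sub>1 c) \<tau>)) *
       covers V\<^sub>3 E\<^sub>3 (filter (\<lambda>c. \<not> touches V\<^sub>2 c) (filter (\<lambda>c. \<not> touches V\<^sub>1 c) \<tau>))"
    if "\<tau> \<in> set (routes es \<sigma>)" for \<tau>
  proof -
    have anch: "\<forall>c\<in>set \<tau>. touches (V\<^sub>1 \<union> V\<^sub>2 \<union> V\<^sub>3) c"
      by (rule routes_anchored[OF that \<sigma> es(2)])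
    have "covers (V\<^sub>1 \<union> (V\<^sub>2 \<union> V\<^sub>3)) (E\<^sub>1 \<union> (E\<^sub>2 \<union> E\<^sub>3)) \<tau> = covers V\<^sub>1 E\<^sub>1 (filter (touches V\<^sub>1) \<tau>) *
        covers (V\<^sub>2 \<union> V\<^sub>3) (E\<^sub>2 \<union> E\<^sub>3) (filter (\<lambda>c. \<not> touches V\<^sub>1 c) \<tau>)"
      using wf disj anch by (intro covers_Un_disjoint) (auto simp: Un_assoc)
    also have "covers (V\<^sub>2 \<union> V\<^sub>3) (E\<^sub>2 \<union> E\<^sub>3) (filter (\<lambda>c. \<not> touches V\<^sub>1 c) \<tau>) =
        covers V\<^sub>2 E\<^sub>2 (filter (touches V\<^sub>2) (filter (\<lambda>c. \<not> touches V\<^sub>1 c) \<tau>)) *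
        covers V\<^sub>3 E\<^sub>3 (filter (\<lambda>c. \<not> touches V\<^sub>2 c) (filter (\<lambda>c. \<not> touches V\<^sub>1 c) \<tau>))"
    proof (rule covers_Un_disjoint)
      show "\<forall>c\<in>set (filter (\<lambda>c. \<not> touches V\<^sub>1 c) \<tau>). touches (V\<^sub>2 \<union> V\<^sub>3) c"
        using anch by (force simp: touches_Un)
    qed (use wf disj in auto)
    finally show ?thesis by (simp add: Un_assoc mult.assoc)
  qed
  then show ?thesis
    using covers_add_edges[of "V\<^sub>1 \<union> V\<^sub>2 \<union> V\<^sub>3" es "E\<^sub>1 \<union> E\<^sub>2 \<union> E\<^sub>3" \<sigma>] wf(1-3) es(1)
    by (simp cong: map_cong)
qed

text \<open>
  These equations permute their left-hand sides; ordered rewriting with them brings all systems of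
  at most two paths into a normal form.
\<close>

lemma covers_sym:
  assumes "sym E" "finite V"
  shows "covers V E [(A, B)] = covers V E [(B, A)]"
    "covers V E [(A, B), c] = covers V E [(B, A), c]"
    "covers V E [c, (A, B)] = covers V E [c, (B, A)]"
    "covers V E [c, d] = covers V E [d, c]"
  using assms by (auto simp only: intro: covers_rev covers_rev2 covers_swap)

lemma covers_foreign:
  "x \<notin> V \<Longrightarrow> covers V E ((Some x, B) # \<sigma>) = 0"
  "x \<notin> V \<Longrightarrow> covers V E ((A, Some x) # \<sigma>) = 0"
  "x \<notin> V \<Longrightarrow> covers V E (c # (Some x, B) # \<sigma>) = 0"
  "x \<notin> V \<Longrightarrow> covers V E (c # (A, Some x) # \<sigma>) = 0"
  using covers_end_outside[of "(Some x, B)"] covers_end_outside[of "(A, Some x)"]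
  by (simp_all add: touches_end)

section \<open>The profile of a gadget\<close>

text \<open>
  The six numbers depend only on \<open>k\<close>. The first letter tells the kind of system: \<open>e\<close> for one path
  from a port to a free end, \<open>s\<close> for a path from a port to a free end together with a path joining
  the other two ports, and \<open>d\<close> for two paths, each from a port to a free end. The ports named
  after it are those at which a path with a free end starts. The two leaf ports are interchangeable, which is why \<open>b\<close> does
  not need numbers of its own. No other system occurs when a Hamiltonian path crosses a gadget: it
  has at most two free ends, and it can leave through each port only once.
\<close>

definition profile ::
    "'a pair_pre_digraph \<Rightarrow> 'a \<Rightarrow> 'a \<Rightarrow> 'a \<Rightarrow> nat \<Rightarrow> nat \<Rightarrow> nat \<Rightarrow> nat \<Rightarrow> nat \<Rightarrow> nat \<Rightarrow> bool" where
  "profile G r a b er ea sr sa dab dra \<longleftrightarrow>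
     (let N = covers (pverts G) (parcs G) in
       N [(Some r, Some a)] = 1 \<and> N [(Some r, Some b)] = 1 \<and> N [(Some a, Some b)] = 1 \<and>
       N [(Some r, None)] = er \<and> N [(Some a, None)] = ea \<and> N [(Some b, None)] = ea \<and>
       N [(Some r, None), (Some a, Some b)] = sr \<and>
       N [(Some a, None), (Some r, Some b)] = sa \<and>
       N [(Some b, None), (Some r, Some a)] = sa \<and>
       N [(Some a, None), (Some b, None)] = dab \<and>
       N [(Some r, None), (Some a, None)] = dra \<and>
       N [(Some r, None), (Some b, None)] = dra)"

text \<open>
  Evaluation goes in two passes: \<open>route_simps\<close> unfolds the cut systems and distributes their paths
  over the parts, \<open>value_simps\<close> evaluates the counts of single vertices and drops the zero terms.
  What is left are counts of single gadgets, which match the profile once \<open>covers_sym\<close> has brought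
  both to the same form.
\<close>

lemmas route_simps = routes.simps splits.simps list.map concat.simps append.simps
  sum_list.Cons sum_list.Nil filter.simps touches_simps singleton_iff if_True if_False simp_thms
lemmas value_simps = covers_single covers.simps(1) insert_iff empty_iff option.inject option.distinct
  list.distinct if_True if_False simp_thms mult_0 mult_0_right add_0 add_0_right mult_1 mult_1_right
  insert_not_empty refl

text \<open>
  Each new value is the sum over all ways in which the path systems of the glued gadget use the
  three connecting edges. For example, a path from the leaf port \<open>a\<close> to a free end either covers
  \<open>D\<close>, passes \<open>q\<close> and ends in \<open>E\<close> (\<open>er\<close>), or covers \<open>D\<close> and \<open>E\<close> and ends at \<open>q\<close> (1), or leaves \<open>D\<close>
  through \<open>b\<close> or \<open>r\<close>, covers \<open>E\<close> and \<open>q\<close>, and comes back to \<open>D\<close> through the other of the two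
  (\<open>sr\<close> and \<open>sa\<close>).
\<close>

lemma profile_step:
  assumes DT: "BT' k D r a b" and ET: "BT' k E r' a' b'"
    and disj: "pverts D \<inter> pverts E = {}" and q: "q \<notin> pverts D \<union> pverts E"
    and D: "profile D r a b er ea sr sa dab dra"
    and E: "profile E r' a' b' er ea sr sa dab dra"
  shows "profile
      \<lparr> pverts = insert q (pverts D \<union> pverts E),
        parcs = parcs D \<union> parcs E \<union> {(q, r), (r, q), (q, r'), (r', q), (b, a'), (a', b)} \<rparr>
      q a b' (2 * ea) (er + 1 + sr + sa) (1 + 2 * sr) (ea + 2 * sa)
      (2 * (ea + 2 * sa + dra + 2 * (sa * sr) + sa * sa))
      (ea + sr * ea + sa * ea + er * ea + dab + dra)"
proof -
  have wf: "finite (pverts D)" "finite (pverts E)" "sym (parcs D)" "sym (parcs E)"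
      "parcs D \<subseteq> pverts D \<times> pverts D" "parcs E \<subseteq> pverts E \<times> pverts E"
    and ports: "r \<in> pverts D" "a \<in> pverts D" "b \<in> pverts D" "r' \<in> pverts E" "a' \<in> pverts E" "b' \<in> pverts E"
    using BT'_ports[OF DT] BT'_ports[OF ET] by (auto simp: pair_graph_iff)
  have other: "r \<notin> pverts E" "a \<notin> pverts E" "b \<notin> pverts E" "r' \<notin> pverts D" "a' \<notin> pverts D" "b' \<notin> pverts D"
      "q \<notin> pverts D" "q \<notin> pverts E" "pverts D \<noteq> {}" "pverts E \<noteq> {}"
      "r \<noteq> q" "a \<noteq> q" "b \<noteq> q" "r' \<noteq> q" "a' \<noteq> q" "b' \<noteq> q"
    using ports disj q by auto
  let ?es = "[(q, r), (q, r'), (b, a')]"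
  let ?V = "insert q (pverts D \<union> pverts E)"
  let ?E = "parcs D \<union> parcs E \<union> {(q, r), (r, q), (q, r'), (r', q), (b, a'), (a', b)}"
  have V: "?V = {q} \<union> pverts D \<union> pverts E" by simp
  have arcs: "?E = arcs_of ?es \<union> ({} \<union> parcs D \<union> parcs E)" by auto
  have new: "new_edges ?es ({} \<union> parcs D \<union> parcs E)"
  proof -
    have "(x, y) \<notin> parcs D \<union> parcs E" if "x \<notin> pverts D \<or> y \<notin> pverts D" "x \<notin> pverts E \<or> y \<notin> pverts E" for x y
      using that wf(5,6) by blast
    moreover have "r \<noteq> r'" "b \<noteq> a'" using ports other by metis+
    ultimately show ?thesis using ports other by simp
  qed
  have count: "covers ?V ?E \<sigma> = (\<Sum>\<tau>\<leftarrow>routes ?es \<sigma>.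
       covers {q} {} (filter (touches {q}) \<tau>) *
       covers (pverts D) (parcs D) (filter (touches (pverts D)) (filter (\<lambda>c. \<not> touches {q} c) \<tau>)) *
       covers (pverts E) (parcs E) (filter (\<lambda>c. \<not> touches (pverts D) c) (filter (\<lambda>c. \<not> touches {q} c) \<tau>)))"
    if "\<forall>c\<in>set \<sigma>. touches ?V c" for \<sigma>
    unfolding V arcs using that
    by (intro covers_three_parts new) (use wf(1,2,5,6) ports disj q in auto)
  note DE = D[unfolded profile_def Let_def] E[unfolded profile_def Let_def]
  note eval = covers_foreign ports other other(11-)[symmetric]
    covers_sym[OF wf(3,1)] covers_sym[OF wf(4,2)]
  show ?thesis
    unfolding profile_def Let_def pair_pre_digraph.simps
    by (intro conjI; subst count, simp add: ports,
        simp only: route_simps ports other other(11-)[symmetric], simp only: value_simps eval,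
        use DE in \<open>simp only: covers_sym[OF wf(3,1)] covers_sym[OF wf(4,2)] mult_1 mult_1_right add_0 mult_0;
          simp add: algebra_simps\<close>)
qed

lemma profile_base:
  assumes K3: "complete_digraph 3 (with_proj G)" and V: "pverts G = {r, a, b}"
  shows "profile G r a b 2 2 1 1 2 2"
proof -
  have ports: "r \<noteq> a" "r \<noteq> b" "a \<noteq> b" "a \<noteq> r" "b \<noteq> r" "b \<noteq> a"
    using K3 V by (auto simp: complete_digraph_def card_insert_if split: if_splits)
  have V': "pverts G = {r} \<union> {a} \<union> {b}" using V by auto
  have arcs: "parcs G = arcs_of [(r, a), (r, b), (a, b)] \<union> ({} \<union> {} \<union> {})"
    using K3 V ports by (auto simp: complete_digraph_pair_def)
  have count: "covers (pverts G) (parcs G) \<sigma> = (\<Sum>\<tau>\<leftarrow>routes [(r, a), (r, b), (a, b)] \<sigma>.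
       covers {r} {} (filter (touches {r}) \<tau>) *
       covers {a} {} (filter (touches {a}) (filter (\<lambda>c. \<not> touches {r} c) \<tau>)) *
       covers {b} {} (filter (\<lambda>c. \<not> touches {a} c) (filter (\<lambda>c. \<not> touches {r} c) \<tau>)))"
    if "\<forall>c\<in>set \<sigma>. touches (pverts G) c" for \<sigma>
    unfolding V' arcs using that
    by (intro covers_three_parts) (use ports V' in auto)
  show ?thesis
    unfolding profile_def Let_def
    by (intro conjI; subst count, simp add: V,
        simp only: route_simps ports, simp only: value_simps ports, simp?)
qed

section \<open>Three gadgets around a center\<close>

text \<open>
  $BT_{k+1}$ without its center: three gadgets whose leaf ports are joined cyclically. A
  Hamiltonian path that starts at the center leaves behind one path from a root port (\<open>X\<close>); one
  that passes through the center leaves behind two paths from two different root ports (\<open>Y\<close>).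
\<close>

lemma ring_counts:
  assumes BT: "BT' k D r\<^sub>0 a\<^sub>0 b\<^sub>0" "BT' k E r\<^sub>1 a\<^sub>1 b\<^sub>1" "BT' k F r\<^sub>2 a\<^sub>2 b\<^sub>2"
    and disj: "pverts D \<inter> pverts E = {}" "pverts D \<inter> pverts F = {}" "pverts E \<inter> pverts F = {}"
    and D: "profile D r\<^sub>0 a\<^sub>0 b\<^sub>0 er ea sr sa dab dra"
    and E: "profile E r\<^sub>1 a\<^sub>1 b\<^sub>1 er ea sr sa dab dra"
    and F: "profile F r\<^sub>2 a\<^sub>2 b\<^sub>2 er ea sr sa dab dra"
  defines "V \<equiv> pverts D \<union> pverts E \<union> pverts F"
    and "A \<equiv> arcs_of [(b\<^sub>0, a\<^sub>1), (b\<^sub>1, a\<^sub>2), (b\<^sub>2, a\<^sub>0)] \<union> (parcs D \<union> parcs E \<union> parcs F)"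
    and "X \<equiv> 2 * (ea + sa)"
    and "Y \<equiv> 2 * er * ea + dab + 2 * dra + 2 * (sa + sr) * ea + 4 * sa * sr + 2 * sa * sa"
  shows "covers V A [(Some r\<^sub>0, None)] = X" "covers V A [(Some r\<^sub>1, None)] = X"
    "covers V A [(Some r\<^sub>2, None)] = X"
    "covers V A [(Some r\<^sub>0, None), (Some r\<^sub>1, None)] = Y"
    "covers V A [(Some r\<^sub>0, None), (Some r\<^sub>2, None)] = Y"
    "covers V A [(Some r\<^sub>1, None), (Some r\<^sub>2, None)] = Y"
proof -
  have wf: "finite (pverts D)" "finite (pverts E)" "finite (pverts F)"
      "sym (parcs D)" "sym (parcs E)" "sym (parcs F)"
      "parcs D \<subseteq> pverts D \<times> pverts D" "parcs E \<subseteq> pverts E \<times> pverts E" "parcs F \<subseteq> pverts F \<times> pverts F"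
    and ports: "r\<^sub>0 \<in> pverts D" "a\<^sub>0 \<in> pverts D" "b\<^sub>0 \<in> pverts D"
      "r\<^sub>1 \<in> pverts E" "a\<^sub>1 \<in> pverts E" "b\<^sub>1 \<in> pverts E"
      "r\<^sub>2 \<in> pverts F" "a\<^sub>2 \<in> pverts F" "b\<^sub>2 \<in> pverts F"
    using BT[THEN BT'_ports] by (auto simp: pair_graph_iff)
  have other: "r\<^sub>0 \<notin> pverts E" "a\<^sub>0 \<notin> pverts E" "b\<^sub>0 \<notin> pverts E"
      "r\<^sub>0 \<notin> pverts F" "a\<^sub>0 \<notin> pverts F" "b\<^sub>0 \<notin> pverts F"
      "r\<^sub>1 \<notin> pverts D" "a\<^sub>1 \<notin> pverts D" "b\<^sub>1 \<notin> pverts D"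
      "r\<^sub>1 \<notin> pverts F" "a\<^sub>1 \<notin> pverts F" "b\<^sub>1 \<notin> pverts F"
      "r\<^sub>2 \<notin> pverts D" "a\<^sub>2 \<notin> pverts D" "b\<^sub>2 \<notin> pverts D"
      "r\<^sub>2 \<notin> pverts E" "a\<^sub>2 \<notin> pverts E" "b\<^sub>2 \<notin> pverts E"
      "pverts D \<noteq> {}" "pverts E \<noteq> {}" "pverts F \<noteq> {}"
    using ports disj by auto
  let ?es = "[(b\<^sub>0, a\<^sub>1), (b\<^sub>1, a\<^sub>2), (b\<^sub>2, a\<^sub>0)]"
  have new: "new_edges ?es (parcs D \<union> parcs E \<union> parcs F)"
  proof -
    have "(x, y) \<notin> parcs D \<union> parcs E \<union> parcs F"
      if "x \<notin> pverts D \<or> y \<notin> pverts D" "x \<notin> pverts E \<or> y \<notin> pverts E" "x \<notin> pverts F \<or> y \<notin> pverts F" for x y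
      using that wf(7-9) by blast
    moreover have "b\<^sub>0 \<noteq> a\<^sub>1" "b\<^sub>1 \<noteq> a\<^sub>2" "b\<^sub>2 \<noteq> a\<^sub>0" "b\<^sub>0 \<noteq> b\<^sub>1" "b\<^sub>0 \<noteq> b\<^sub>2" "b\<^sub>1 \<noteq> b\<^sub>2" "b\<^sub>0 \<noteq> a\<^sub>2" "b\<^sub>1 \<noteq> a\<^sub>0" "b\<^sub>2 \<noteq> a\<^sub>1"
      using ports other by metis+
    ultimately show ?thesis using other by auto
  qed
  have count: "covers V A \<sigma> = (\<Sum>\<tau>\<leftarrow>routes ?es \<sigma>.
       covers (pverts D) (parcs D) (filter (touches (pverts D)) \<tau>) *
       covers (pverts E) (parcs E) (filter (touches (pverts E)) (filter (\<lambda>c. \<not> touches (pverts D) c) \<tau>)) *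
       covers (pverts F) (parcs F) (filter (\<lambda>c. \<not> touches (pverts E) c) (filter (\<lambda>c. \<not> touches (pverts D) c) \<tau>)))"
    if "\<forall>c\<in>set \<sigma>. touches V c" for \<sigma>
    unfolding V_def A_def using that
    by (intro covers_three_parts new) (use wf(1-3,7-9) ports disj V_def in auto)
  note DEF = D[unfolded profile_def Let_def] E[unfolded profile_def Let_def] F[unfolded profile_def Let_def]
  note syms = covers_sym[OF wf(4,1)] covers_sym[OF wf(5,2)] covers_sym[OF wf(6,3)]
  note eval = covers_foreign ports other syms
  show "covers V A [(Some r\<^sub>0, None)] = X" "covers V A [(Some r\<^sub>1, None)] = X"
    "covers V A [(Some r\<^sub>2, None)] = X"
    "covers V A [(Some r\<^sub>0, None), (Some r\<^sub>1, None)] = Y"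
    "covers V A [(Some r\<^sub>0, None), (Some r\<^sub>2, None)] = Y"
    "covers V A [(Some r\<^sub>1, None), (Some r\<^sub>2, None)] = Y"
    unfolding X_def Y_def
    by (subst count, simp add: V_def ports,
        simp only: route_simps ports other, simp only: value_simps eval,
        use DEF in \<open>simp only: syms mult_1 mult_1_right add_0 mult_0;
          simp add: algebra_simps\<close>)+
qed

text \<open>
  A path with two free ends is not anchored, but after the first cut both halves are.
\<close>

lemma routes_free_anchored:
  assumes "\<tau> \<in> set (routes es [(None, None)])" "set es \<subseteq> W \<times> W" "\<tau> \<noteq> [(None, None)]"
  shows "\<forall>c\<in>set \<tau>. touches W c"
  using assms
proof (induction es)
  case (Cons e es)
  obtain u v where e: "e = (u, v)" by fastforce
  show ?case
  proof (cases "\<tau> \<in> set (routes es [(None, None)])")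
    case False
    then obtain \<sigma> where "\<sigma> \<in> set (splits u v [(None, None)] @ splits v u [(None, None)])"
        "\<tau> \<in> set (routes es \<sigma>)"
      using Cons.prems(1) by (auto simp: e)
    then show ?thesis
      using Cons.prems(2) by (intro routes_anchored[of \<tau> es \<sigma>]) (auto simp: e touches_end)
  qed (use Cons in auto)
qed auto

lemma covers_free_two_parts:
  assumes wf: "finite V\<^sub>1" "finite V\<^sub>2" "E\<^sub>1 \<subseteq> V\<^sub>1 \<times> V\<^sub>1" "E\<^sub>2 \<subseteq> V\<^sub>2 \<times> V\<^sub>2"
    and disj: "V\<^sub>1 \<inter> V\<^sub>2 = {}" "V\<^sub>1 \<noteq> {}" "V\<^sub>2 \<noteq> {}"
    and es: "new_edges es (E\<^sub>1 \<union> E\<^sub>2)" "set es \<subseteq> (V\<^sub>1 \<union> V\<^sub>2) \<times> (V\<^sub>1 \<union> V\<^sub>2)"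
  shows "covers (V\<^sub>1 \<union> V\<^sub>2) (arcs_of es \<union> (E\<^sub>1 \<union> E\<^sub>2)) [(None, None)] =
    (\<Sum>\<tau>\<leftarrow>routes es [(None, None)].
       covers V\<^sub>1 E\<^sub>1 (filter (touches V\<^sub>1) \<tau>) * covers V\<^sub>2 E\<^sub>2 (filter (\<lambda>c. \<not> touches V\<^sub>1 c) \<tau>))"
proof -
  have "covers (V\<^sub>1 \<union> V\<^sub>2) (E\<^sub>1 \<union> E\<^sub>2) \<tau> =
      covers V\<^sub>1 E\<^sub>1 (filter (touches V\<^sub>1) \<tau>) * covers V\<^sub>2 E\<^sub>2 (filter (\<lambda>c. \<not> touches V\<^sub>1 c) \<tau>)"
    if "\<tau> \<in> set (routes es [(None, None)])" for \<tau>
  proof (cases "\<tau> = [(None, None)]")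
    case True
    then show ?thesis using covers_disconnected[OF wf(3,4) disj] disj by simp
  next
    case False
    then show ?thesis
      using wf disj routes_free_anchored[OF that es(2)] by (intro covers_Un_disjoint) auto
  qed
  then show ?thesis
    using covers_add_edges[of "V\<^sub>1 \<union> V\<^sub>2" es "E\<^sub>1 \<union> E\<^sub>2"] wf(1,2) es(1) by (simp cong: map_cong)
qed

text \<open>
  The center is an end of an oriented Hamiltonian path in two ways for each of the three neighbours
  it may have on the path, and an inner vertex in one way for each ordered pair of different
  neighbours.
\<close>

lemma hub_count:
  assumes V: "finite V" "c \<notin> V" "r\<^sub>0 \<in> V" "r\<^sub>1 \<in> V" "r\<^sub>2 \<in> V" "r\<^sub>0 \<noteq> r\<^sub>1" "r\<^sub>0 \<noteq> r\<^sub>2" "r\<^sub>1 \<noteq> r\<^sub>2"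
    and A: "A \<subseteq> V \<times> V" "sym A"
    and X: "covers V A [(Some r\<^sub>0, None)] = X" "covers V A [(Some r\<^sub>1, None)] = X" "covers V A [(Some r\<^sub>2, None)] = X"
    and Y: "covers V A [(Some r\<^sub>0, None), (Some r\<^sub>1, None)] = Y"
      "covers V A [(Some r\<^sub>0, None), (Some r\<^sub>2, None)] = Y"
      "covers V A [(Some r\<^sub>1, None), (Some r\<^sub>2, None)] = Y"
  shows "covers (insert c V) (arcs_of [(c, r\<^sub>0), (c, r\<^sub>1), (c, r\<^sub>2)] \<union> A) [(None, None)] = 6 * X + 6 * Y"
proof -
  let ?es = "[(c, r\<^sub>0), (c, r\<^sub>1), (c, r\<^sub>2)]"
  have ne: "c \<noteq> r\<^sub>0" "c \<noteq> r\<^sub>1" "c \<noteq> r\<^sub>2" "r\<^sub>0 \<noteq> c" "r\<^sub>1 \<noteq> c" "r\<^sub>2 \<noteq> c" "V \<noteq> {}" using V by auto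
  have "(x, c) \<notin> A" "(c, x) \<notin> A" for x using A(1) V(2) by blast+
  then have new: "new_edges ?es ({} \<union> A)" using ne V(6-8) by simp
  have "covers (insert c V) (arcs_of ?es \<union> A) [(None, None)] = covers ({c} \<union> V) (arcs_of ?es \<union> ({} \<union> A)) [(None, None)]"
    by simp
  also have "\<dots> = (\<Sum>\<tau>\<leftarrow>routes ?es [(None, None)].
       covers {c} {} (filter (touches {c}) \<tau>) * covers V A (filter (\<lambda>d. \<not> touches {c} d) \<tau>))"
    by (intro covers_free_two_parts new) (use V A in auto)
  also have "\<dots> = 6 * X + 6 * Y"
    by (simp only: route_simps ne, simp only: value_simps ne,
        use X Y in \<open>simp only: covers_sym[OF A(2) V(1)]; simp\<close>)
  finally show ?thesis .
qed

lemma BT'_pos: "BT' k G r a b \<Longrightarrow> k \<ge> 1"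
  by (erule BT'.cases) auto

lemma card_BT': "BT' k G r a b \<Longrightarrow> card (pverts G) = 2 ^ Suc k - 1"
proof (induction rule: BT'.induct)
  case (base G r a b)
  then show ?case by (simp add: complete_digraph_def)
next
  case (step k D r a b E r' a' b' q)
  have "finite (pverts D)" "finite (pverts E)"
    using BT'_ports[OF step.hyps(1)] BT'_ports[OF step.hyps(2)] by (auto simp: pair_graph_iff)
  then have "card (insert q (pverts D \<union> pverts E)) = Suc ((2 ^ Suc k - 1) + (2 ^ Suc k - 1))"
    using step by (simp add: card_Un_disjoint)
  moreover have "(1::nat) \<le> 2 ^ Suc k" by simp
  ultimately show ?case unfolding pair_pre_digraph.simps power_Suc[of 2 "Suc k"] by linarith
qed

text \<open>
  Two edges of the matching cannot join the same two pairs, since the ports of the third pair would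
  then have only each other as partners. So each two of the three pairs are joined by exactly one
  edge, and the freedom that remains is which port of a pair, \<open>q\<close>, leads to the next pair.
\<close>

lemma cross_matching_cyclic:
  assumes dist: "distinct [a\<^sub>0, b\<^sub>0, a\<^sub>1, b\<^sub>1, a\<^sub>2, b\<^sub>2]"
    and part: "partition_on {a\<^sub>0, b\<^sub>0, a\<^sub>1, b\<^sub>1, a\<^sub>2, b\<^sub>2} M"
    and cross: "\<And>e. e \<in> M \<Longrightarrow> \<exists>u v. e = {u, v} \<and>
      (u \<in> {a\<^sub>0, b\<^sub>0} \<and> v \<in> {a\<^sub>1, b\<^sub>1} \<or> u \<in> {a\<^sub>1, b\<^sub>1} \<and> v \<in> {a\<^sub>2, b\<^sub>2} \<or> u \<in> {a\<^sub>2, b\<^sub>2} \<and> v \<in> {a\<^sub>0, b\<^sub>0})"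
  shows "\<exists>p\<^sub>0 q\<^sub>0 p\<^sub>1 q\<^sub>1 p\<^sub>2 q\<^sub>2. (p\<^sub>0, q\<^sub>0) \<in> {(a\<^sub>0, b\<^sub>0), (b\<^sub>0, a\<^sub>0)} \<and> (p\<^sub>1, q\<^sub>1) \<in> {(a\<^sub>1, b\<^sub>1), (b\<^sub>1, a\<^sub>1)}
    \<and> (p\<^sub>2, q\<^sub>2) \<in> {(a\<^sub>2, b\<^sub>2), (b\<^sub>2, a\<^sub>2)} \<and> M = {{q\<^sub>0, p\<^sub>1}, {q\<^sub>1, p\<^sub>2}, {q\<^sub>2, p\<^sub>0}}"
proof -
  let ?P = "{a\<^sub>0, b\<^sub>0, a\<^sub>1, b\<^sub>1, a\<^sub>2, b\<^sub>2}"
  define m where "m x y \<longleftrightarrow> {x, y} \<in> M" for x y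
  have uniq: "e = e'" if "e \<in> M" "e' \<in> M" "x \<in> e" "x \<in> e'" for e e' x
    using part that unfolding partition_on_def disjoint_def by blast
  have m_sym: "m y x" if "m x y" for x y
    using that by (simp add: m_def insert_commute)
  have m_fun: "y = z" if "m x y" "m x z" for x y z
    using that uniq[of "{x, y}" "{x, z}" x] by (auto simp: m_def doubleton_eq_iff)
  have mate: "\<exists>y. m x y \<and> (x \<in> {a\<^sub>0, b\<^sub>0} \<and> y \<in> {a\<^sub>1, b\<^sub>1} \<union> {a\<^sub>2, b\<^sub>2} \<or>
      x \<in> {a\<^sub>1, b\<^sub>1} \<and> y \<in> {a\<^sub>0, b\<^sub>0} \<union> {a\<^sub>2, b\<^sub>2} \<or> x \<in> {a\<^sub>2, b\<^sub>2} \<and> y \<in> {a\<^sub>0, b\<^sub>0} \<union> {a\<^sub>1, b\<^sub>1})"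
    if "x \<in> ?P" for x
  proof -
    from that part obtain e where e: "e \<in> M" "x \<in> e" unfolding partition_on_def by blast
    from cross[OF e(1)] obtain u v where uv: "e = {u, v}"
      "u \<in> {a\<^sub>0, b\<^sub>0} \<and> v \<in> {a\<^sub>1, b\<^sub>1} \<or> u \<in> {a\<^sub>1, b\<^sub>1} \<and> v \<in> {a\<^sub>2, b\<^sub>2} \<or> u \<in> {a\<^sub>2, b\<^sub>2} \<and> v \<in> {a\<^sub>0, b\<^sub>0}"
      by blast
    have "m u v" "m v u" using e(1) uv(1) by (simp_all add: m_def insert_commute)
    moreover have "x = u \<or> x = v" using e uv by blast
    ultimately show ?thesis using uv(2) by blast
  qed
  have disj: "{a\<^sub>0, b\<^sub>0} \<inter> {a\<^sub>1, b\<^sub>1} = {}" "{a\<^sub>0, b\<^sub>0} \<inter> {a\<^sub>2, b\<^sub>2} = {}" "{a\<^sub>1, b\<^sub>1} \<inter> {a\<^sub>2, b\<^sub>2} = {}"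
    and neq: "a\<^sub>0 \<noteq> b\<^sub>0" "a\<^sub>1 \<noteq> b\<^sub>1" "a\<^sub>2 \<noteq> b\<^sub>2"
    using dist by auto
  have mate0: "\<exists>y\<in>{a\<^sub>1, b\<^sub>1} \<union> {a\<^sub>2, b\<^sub>2}. m x y" if "x \<in> {a\<^sub>0, b\<^sub>0}" for x using mate[of x] that disj by blast
  have mate1: "\<exists>y\<in>{a\<^sub>0, b\<^sub>0} \<union> {a\<^sub>2, b\<^sub>2}. m x y" if "x \<in> {a\<^sub>1, b\<^sub>1}" for x using mate[of x] that disj by blast
  have mate2: "\<exists>y\<in>{a\<^sub>0, b\<^sub>0} \<union> {a\<^sub>1, b\<^sub>1}. m x y" if "x \<in> {a\<^sub>2, b\<^sub>2}" for x using mate[of x] that disj by blast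
  (* otherwise pairs 0 and 1 would both be matched into pair 2 *)
  have "\<exists>q\<^sub>0\<in>{a\<^sub>0, b\<^sub>0}. \<exists>p\<^sub>1\<in>{a\<^sub>1, b\<^sub>1}. m q\<^sub>0 p\<^sub>1"
  proof (rule ccontr)
    assume none: "\<not> ?thesis"
    obtain y z where yz: "y \<in> {a\<^sub>2, b\<^sub>2}" "m a\<^sub>1 y" "z \<in> {a\<^sub>2, b\<^sub>2}" "m b\<^sub>1 z"
      using mate1[of a\<^sub>1] mate1[of b\<^sub>1] none m_sym by blast
    then have "y \<noteq> z" using m_sym m_fun neq(2) by metis
    with yz have S2: "{a\<^sub>2, b\<^sub>2} = {y, z}" by blast
    obtain w where "w \<in> {a\<^sub>2, b\<^sub>2}" "m a\<^sub>0 w" using mate0[of a\<^sub>0] none by blast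
    then have "w = y \<or> w = z" using S2 by blast
    then have "a\<^sub>0 = a\<^sub>1 \<or> a\<^sub>0 = b\<^sub>1"
      using m_fun[OF m_sym[OF \<open>m a\<^sub>0 w\<close>]] m_sym[OF yz(2)] m_sym[OF yz(4)] by blast
    then show False using disj by blast
  qed
  then obtain q\<^sub>0 p\<^sub>1 where e01: "q\<^sub>0 \<in> {a\<^sub>0, b\<^sub>0}" "p\<^sub>1 \<in> {a\<^sub>1, b\<^sub>1}" "m q\<^sub>0 p\<^sub>1" by blast
  then obtain p\<^sub>0 q\<^sub>1 where pq: "(p\<^sub>0, q\<^sub>0) \<in> {(a\<^sub>0, b\<^sub>0), (b\<^sub>0, a\<^sub>0)}" "(p\<^sub>1, q\<^sub>1) \<in> {(a\<^sub>1, b\<^sub>1), (b\<^sub>1, a\<^sub>1)}" by blast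
  have S: "{a\<^sub>0, b\<^sub>0} = {p\<^sub>0, q\<^sub>0}" "{a\<^sub>1, b\<^sub>1} = {p\<^sub>1, q\<^sub>1}" and ne: "p\<^sub>0 \<noteq> q\<^sub>0" "p\<^sub>1 \<noteq> q\<^sub>1"
    using pq neq by auto
  note disj = disj[unfolded S] and mates = mate0[unfolded S] mate1[unfolded S] mate2[unfolded S]
  (* otherwise no port would be left for pair 2 *)
  have "\<not> m p\<^sub>0 q\<^sub>1"
  proof
    assume "m p\<^sub>0 q\<^sub>1"
    then have "\<forall>y\<in>{p\<^sub>0, q\<^sub>0} \<union> {p\<^sub>1, q\<^sub>1}. \<exists>z\<in>{p\<^sub>0, q\<^sub>0} \<union> {p\<^sub>1, q\<^sub>1}. m y z"
      using e01(3) m_sym by auto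
    moreover obtain y where y: "m a\<^sub>2 y" "y \<in> {p\<^sub>0, q\<^sub>0} \<union> {p\<^sub>1, q\<^sub>1}" using mates(3)[of a\<^sub>2] by blast
    ultimately obtain z where "z \<in> {p\<^sub>0, q\<^sub>0} \<union> {p\<^sub>1, q\<^sub>1}" "m y z" by blast
    with m_fun[OF m_sym[OF y(1)]] have "a\<^sub>2 \<in> {p\<^sub>0, q\<^sub>0} \<union> {p\<^sub>1, q\<^sub>1}" by metis
    then show False using disj by blast
  qed
  moreover have "\<not> m p\<^sub>0 p\<^sub>1" using e01(3) ne(1) m_sym m_fun by blast
  ultimately obtain q\<^sub>2 where q2: "q\<^sub>2 \<in> {a\<^sub>2, b\<^sub>2}" "m p\<^sub>0 q\<^sub>2" using mates(1)[of p\<^sub>0] by blast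
  have "\<not> m q\<^sub>1 q\<^sub>0" using e01(3) ne(2) m_sym m_fun by blast
  then obtain p\<^sub>2 where p2: "p\<^sub>2 \<in> {a\<^sub>2, b\<^sub>2}" "m q\<^sub>1 p\<^sub>2"
    using mates(2)[of q\<^sub>1] \<open>\<not> m p\<^sub>0 q\<^sub>1\<close> m_sym by blast
  have "p\<^sub>2 \<noteq> q\<^sub>2" using m_fun[OF m_sym[OF p2(2)], of p\<^sub>0] m_sym[OF q2(2)] disj(1) by auto
  then have pq2: "(p\<^sub>2, q\<^sub>2) \<in> {(a\<^sub>2, b\<^sub>2), (b\<^sub>2, a\<^sub>2)}" using p2 q2 by blast
  note pq = pq pq2
  have edges: "m q\<^sub>0 p\<^sub>1" "m q\<^sub>1 p\<^sub>2" "m q\<^sub>2 p\<^sub>0" using e01 p2 q2 m_sym by auto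
  have "M = {{q\<^sub>0, p\<^sub>1}, {q\<^sub>1, p\<^sub>2}, {q\<^sub>2, p\<^sub>0}}" (is "_ = ?N")
  proof
    show "?N \<subseteq> M" using edges by (simp add: m_def)
    show "M \<subseteq> ?N"
    proof
      fix e assume e: "e \<in> M"
      then have "e \<noteq> {}" "e \<subseteq> ?P" using part by (auto simp: partition_on_def)
      then obtain x where x: "x \<in> e" "x \<in> ?P" by blast
      have "?P \<subseteq> \<Union>?N" using pq by auto
      then obtain e' where "e' \<in> ?N" "x \<in> e'" using x(2) by blast
      with uniq[OF e, of e' x] x(1) \<open>?N \<subseteq> M\<close> show "e \<in> ?N" by blast
    qed
  qed
  with pq show ?thesis by blast
qed

text \<open>
  The six leaf ports sit on a cycle up to exchanging the leaf ports of each gadget, so the profile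
  fixes the count whatever the matching is.
\<close>

lemma BT_profile_count:
  fixes G :: "'a pair_pre_digraph"
  assumes BT: "BT (Suc k) G" and k: "k \<ge> 1"
    and prof: "\<And>(G :: 'a pair_pre_digraph) r a b. BT' k G r a b \<Longrightarrow> profile G r a b er ea sr sa dab dra"
  shows "Ham (with_proj G) = 6 * (2 * (ea + sa)) +
    6 * (2 * er * ea + dab + 2 * dra + 2 * (sa + sr) * ea + 4 * sa * sr + 2 * sa * sa)"
    and "card (pverts G) = 3 * 2 ^ Suc k - 2"
proof -
  obtain D :: "nat \<Rightarrow> 'a pair_pre_digraph" and r a b c M where
    G: "G = \<lparr> pverts = insert c (\<Union>i<3. pverts (D i)),
        parcs = (\<Union>i<3. parcs (D i)) \<union> (\<Union>i<3. {(c, r i), (r i, c)}) \<union> {(u, v). {u, v} \<in> M} \<rparr>"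
    and D: "\<And>i. i < 3 \<Longrightarrow> BT' k (D i) (r i) (a i) (b i)"
    and disj: "disjoint_family_on (\<lambda>i. pverts (D i)) {..<3}"
    and c: "c \<notin> (\<Union>i<3. pverts (D i))"
    and part: "partition_on (\<Union>i<3. {a i, b i}) M"
    and cross: "\<And>e. e \<in> M \<Longrightarrow> \<exists>i<3. \<exists>j<3. i \<noteq> j \<and> (\<exists>u\<in>{a i, b i}. \<exists>v\<in>{a j, b j}. e = {u, v})"
    using BT
  proof cases
    case base
    then show ?thesis using k by simp
  next
    case (step D r a b c M)
    show ?thesis by (rule that[OF step])
  qed
  have three: "{..<3::nat} = {0, 1, 2}" by auto
  have BTs: "BT' k (D 0) (r 0) (a 0) (b 0)" "BT' k (D 1) (r 1) (a 1) (b 1)" "BT' k (D 2) (r 2) (a 2) (b 2)"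
    using D by auto
  have dis: "pverts (D 0) \<inter> pverts (D 1) = {}" "pverts (D 0) \<inter> pverts (D 2) = {}" "pverts (D 1) \<inter> pverts (D 2) = {}"
    using disj by (auto simp: disjoint_family_on_def three)
  note ports = BTs[THEN BT'_ports]
  have wf: "finite (pverts (D i))" "parcs (D i) \<subseteq> pverts (D i) \<times> pverts (D i)" "sym (parcs (D i))" if "i < 3" for i
    using BT'_ports[OF D[OF that]] by (auto simp: pair_graph_iff)
  have "\<exists>p\<^sub>0 q\<^sub>0 p\<^sub>1 q\<^sub>1 p\<^sub>2 q\<^sub>2. (p\<^sub>0, q\<^sub>0) \<in> {(a 0, b 0), (b 0, a 0)} \<and> (p\<^sub>1, q\<^sub>1) \<in> {(a 1, b 1), (b 1, a 1)}
    \<and> (p\<^sub>2, q\<^sub>2) \<in> {(a 2, b 2), (b 2, a 2)} \<and> M = {{q\<^sub>0, p\<^sub>1}, {q\<^sub>1, p\<^sub>2}, {q\<^sub>2, p\<^sub>0}}"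
  proof (rule cross_matching_cyclic)
    show "distinct [a 0, b 0, a 1, b 1, a 2, b 2]"
      using ports dis by auto
    show "partition_on {a 0, b 0, a 1, b 1, a 2, b 2} M"
      using part by (simp add: three Un_commute insert_commute)
    fix e assume "e \<in> M"
    from cross[OF this] obtain i j u v where *: "i < 3" "j < 3" "i \<noteq> j" "u \<in> {a i, b i}" "v \<in> {a j, b j}" "e = {u, v}"
      by blast
    from *(1-3) have "(i = 0 \<and> j = 1 \<or> i = 1 \<and> j = 2 \<or> i = 2 \<and> j = 0)
        \<or> (j = 0 \<and> i = 1 \<or> j = 1 \<and> i = 2 \<or> j = 2 \<and> i = 0)" (is "?up \<or> ?down") by auto
    then show "\<exists>u v. e = {u, v} \<and> (u \<in> {a 0, b 0} \<and> v \<in> {a 1, b 1} \<or> u \<in> {a 1, b 1} \<and> v \<in> {a 2, b 2}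
        \<or> u \<in> {a 2, b 2} \<and> v \<in> {a 0, b 0})"
    proof
      assume ?up
      with *(4-6) show ?thesis by (intro exI[of _ u] exI[of _ v]) auto
    next
      assume ?down
      with *(4-6) show ?thesis by (intro exI[of _ v] exI[of _ u]) auto
    qed
  qed
  then obtain p\<^sub>0 q\<^sub>0 p\<^sub>1 q\<^sub>1 p\<^sub>2 q\<^sub>2 where pq: "(p\<^sub>0, q\<^sub>0) \<in> {(a 0, b 0), (b 0, a 0)}" "(p\<^sub>1, q\<^sub>1) \<in> {(a 1, b 1), (b 1, a 1)}"
    "(p\<^sub>2, q\<^sub>2) \<in> {(a 2, b 2), (b 2, a 2)}" and M: "M = {{q\<^sub>0, p\<^sub>1}, {q\<^sub>1, p\<^sub>2}, {q\<^sub>2, p\<^sub>0}}" by blast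
  have BTs': "BT' k (D 0) (r 0) p\<^sub>0 q\<^sub>0" "BT' k (D 1) (r 1) p\<^sub>1 q\<^sub>1" "BT' k (D 2) (r 2) p\<^sub>2 q\<^sub>2"
    using BTs pq BT'_swap by auto
  let ?V = "pverts (D 0) \<union> pverts (D 1) \<union> pverts (D 2)"
  let ?A = "arcs_of [(q\<^sub>0, p\<^sub>1), (q\<^sub>1, p\<^sub>2), (q\<^sub>2, p\<^sub>0)] \<union> (parcs (D 0) \<union> parcs (D 1) \<union> parcs (D 2))"
  note ports' = BTs'[THEN BT'_ports]
  have verts: "pverts G = insert c ?V" by (auto simp: G three)
  have "{(u, v). {u, v} \<in> M} = arcs_of [(q\<^sub>0, p\<^sub>1), (q\<^sub>1, p\<^sub>2), (q\<^sub>2, p\<^sub>0)]"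
    unfolding M by (auto simp: doubleton_eq_iff)
  moreover have "(\<Union>i<3. {(c, r i), (r i, c)}) = arcs_of [(c, r 0), (c, r 1), (c, r 2)]"
    "(\<Union>i<3. parcs (D i)) = parcs (D 0) \<union> parcs (D 1) \<union> parcs (D 2)"
    by (auto simp: three)
  ultimately have arcs: "parcs G = arcs_of [(c, r 0), (c, r 1), (c, r 2)] \<union> ?A"
    unfolding G pair_pre_digraph.simps by (simp only: Un_ac)
  have A: "?A \<subseteq> ?V \<times> ?V" "sym ?A"
  proof -
    have "sym (arcs_of [(q\<^sub>0, p\<^sub>1), (q\<^sub>1, p\<^sub>2), (q\<^sub>2, p\<^sub>0)])" by (auto simp: sym_def)
    then show "sym ?A" using wf(3) by (intro sym_Un) auto
    have "arcs_of [(q\<^sub>0, p\<^sub>1), (q\<^sub>1, p\<^sub>2), (q\<^sub>2, p\<^sub>0)] \<subseteq> ?V \<times> ?V" using ports' by simp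
    moreover have "parcs (D i) \<subseteq> ?V \<times> ?V" if "i \<in> {0, 1, 2}" for i
      using wf(2)[of i] that by auto
    ultimately show "?A \<subseteq> ?V \<times> ?V" by simp
  qed
  have ne: "c \<notin> ?V" "r 0 \<noteq> r 1" "r 0 \<noteq> r 2" "r 1 \<noteq> r 2"
    using c ports dis by (auto simp: three)
  have fin: "finite ?V" using wf(1) by simp
  have "covers (insert c ?V) (arcs_of [(c, r 0), (c, r 1), (c, r 2)] \<union> ?A) [(None, None)]
    = 6 * (2 * (ea + sa)) + 6 * (2 * er * ea + dab + 2 * dra + 2 * (sa + sr) * ea + 4 * sa * sr + 2 * sa * sa)"
    by (rule hub_count[OF fin ne(1) _ _ _ ne(2-4) A ring_counts[OF BTs' dis BTs'[THEN prof]]]) (use ports in simp_all)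
  then show "Ham (with_proj G) = 6 * (2 * (ea + sa)) +
    6 * (2 * er * ea + dab + 2 * dra + 2 * (sa + sr) * ea + 4 * sa * sr + 2 * sa * sa)"
    using Ham_eq_covers[OF BT_pair_graph[OF BT]] by (simp add: verts arcs)
  have "(1::nat) \<le> 2 ^ Suc k" by simp
  moreover have "card (pverts G) = Suc (card (pverts (D 0)) + card (pverts (D 1)) + card (pverts (D 2)))"
    unfolding verts using fin ne(1) dis by (simp add: card_Un_disjoint Int_Un_distrib2)
  ultimately show "card (pverts G) = 3 * 2 ^ Suc k - 2"
    using BTs[THEN card_BT'] by simp
qed

lemma Ham_complete:
  assumes "complete_digraph n (with_proj G)" "n \<ge> 1"
  shows "Ham (with_proj G) = fact n"
proof -
  have G: "finite (pverts G)" "card (pverts G) = n"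
    "parcs G = {(u, v). (u, v) \<in> pverts G \<times> pverts G \<and> u \<noteq> v}"
    using assms by (auto simp: complete_digraph_pair_def)
  have "set (vwalk_arcs p) \<subseteq> parcs G" if "distinct p" "set p \<subseteq> pverts G" for p
    using that by (induction p rule: vwalk_arcs.induct) (auto simp: G(3))
  then have "{p. vpath p (with_proj G) \<and> set p = pverts G} = permutations_of_set (pverts G)"
    using G(1,2) assms(2) by (auto simp: vpath_def vwalk_def permutations_of_set_def arcs_ends_conv)
  then show ?thesis using G by (simp add: Ham_def)
qed

section \<open>Closed forms\<close>

text \<open>
  The Lucas sequences of $x^2-x-4$.
\<close>

definition lucas_V :: "nat \<Rightarrow> real" where
  "lucas_V k = ((1 + sqrt 17) / 2) ^ k + ((1 - sqrt 17) / 2) ^ k"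

definition lucas_W :: "nat \<Rightarrow> real" where
  "lucas_W k = (((1 + sqrt 17) / 2) ^ k - ((1 - sqrt 17) / 2) ^ k) / sqrt 17"

lemma lucas_0: "lucas_V 0 = 2" "lucas_W 0 = 0"
  by (auto simp: lucas_V_def lucas_W_def)

text \<open>
  Multiplication by $(1+\sqrt{17})/2$, in coordinates with respect to $1$ and $\sqrt{17}$. Being of
  first order, this recursion suits inductions that advance one level of the tree, and
  together with \<open>lucas_double\<close> it reduces identities between the closed forms to polynomial ones.
\<close>

lemma lucas_Suc:
  "lucas_V (Suc k) = (lucas_V k + 17 * lucas_W k) / 2"
  "lucas_W (Suc k) = (lucas_V k + lucas_W k) / 2"
proof -
  have s: "sqrt 17 * sqrt 17 = 17" by simp
  have W: "((1 + sqrt 17) / 2) ^ k - ((1 - sqrt 17) / 2) ^ k = sqrt 17 * lucas_W k" for k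
    by (simp add: lucas_W_def)
  define x y where "x = ((1 + sqrt 17) / 2) ^ k" and "y = ((1 - sqrt 17) / 2) ^ k"
  have xy: "x + y = lucas_V k" "x - y = sqrt 17 * lucas_W k"
    using W[of k] by (auto simp: x_def y_def lucas_V_def)
  have "lucas_V (Suc k) = ((x + y) + sqrt 17 * (x - y)) / 2"
    by (simp add: lucas_V_def x_def y_def field_simps)
  also have "\<dots> = (lucas_V k + (sqrt 17 * sqrt 17) * lucas_W k) / 2"
    unfolding xy by (simp only: mult.assoc)
  finally show "lucas_V (Suc k) = (lucas_V k + 17 * lucas_W k) / 2" by (simp only: s)
  have "sqrt 17 * lucas_W (Suc k) = ((x - y) + sqrt 17 * (x + y)) / 2"
    unfolding W[symmetric] by (simp add: x_def y_def field_simps)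
  also have "\<dots> = sqrt 17 * ((lucas_V k + lucas_W k) / 2)"
    unfolding xy by (simp add: field_simps)
  finally show "lucas_W (Suc k) = (lucas_V k + lucas_W k) / 2" by simp
qed

lemma lucas_Suc_Suc:
  "lucas_V (Suc (Suc k)) = lucas_V (Suc k) + 4 * lucas_V k"
  "lucas_W (Suc (Suc k)) = lucas_W (Suc k) + 4 * lucas_W k"
  by (simp_all add: lucas_Suc field_simps)

lemma lucas_double:
  "lucas_V (2 * k) = ((lucas_V k)\<^sup>2 + 17 * (lucas_W k)\<^sup>2) / 2"
  "lucas_W (2 * k) = lucas_V k * lucas_W k"
  by (simp_all add: lucas_V_def lucas_W_def power_mult power_commutes power2_eq_square
      power_mult_distrib field_simps flip: power_even_eq)

lemma lucas_1: "lucas_V (Suc 0) = 1" "lucas_W (Suc 0) = 1" "lucas_V 2 = 9" "lucas_W 2 = 1"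
  using lucas_double[of 1] by (simp_all add: lucas_Suc lucas_0)

lemma recurrence_unique:
  fixes f :: "nat \<Rightarrow> int" and g :: "nat \<Rightarrow> real"
  assumes "real_of_int (f 0) = g 0" "real_of_int (f 1) = g 1"
    and "\<And>j. j \<ge> 1 \<Longrightarrow> f (j + 1) = f j + 4 * f (j - 1)"
    and "\<And>j. g (Suc (Suc j)) = g (Suc j) + 4 * g j"
  shows "real_of_int (f j) = g j"
proof (induction j rule: induct_nat_012)
  case (ge2 j)
  then show ?case using assms(3)[of "Suc j"] assms(4)[of j] by simp
qed (use assms in simp_all)

text \<open>
  The closed forms of \<open>dab\<close> and \<open>dra\<close> contain in addition multiples of $(-4)^k$ and $(-1)^k$, which
  cancel in \<open>dab + 2 * dra\<close>. Only this combination enters the Hamiltonian path count, and it has a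
  recursion of its own: the new value is twice the old one plus terms in the other four numbers.
\<close>

lemma BT'_profile:
  assumes "k \<ge> 1"
  shows "\<exists>er ea sr sa dab dra. (\<forall>(G :: 'a pair_pre_digraph) r a b. BT' k G r a b \<longrightarrow> profile G r a b er ea sr sa dab dra)
    \<and> real er = (lucas_V k + 5 * lucas_W k + 2) / 4
    \<and> real ea = (3 * lucas_V k + 11 * lucas_W k + 2) / 8
    \<and> real sr = 2 ^ k - 1
    \<and> real sa = (5 * lucas_V k + 21 * lucas_W k - 2) / 8 - 2 ^ k
    \<and> real (dab + 2 * dra) = (5 * lucas_V (2 * k) + 21 * lucas_W (2 * k)) / 8
        + (5 * lucas_V k + 21 * lucas_W k) / 4 - 4 ^ k - 2 * 2 ^ k - 3 / 4"
  using assms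
proof (induction k rule: nat_induct_at_least)
  case base
  have "profile G r a b 2 2 1 1 2 2" if "BT' 1 G r a b" for G :: "'a pair_pre_digraph" and r a b
    using that
  proof cases
    case base
    then show ?thesis by (intro profile_base) auto
  next
    case (step k)
    then show ?thesis using BT'_pos by fastforce
  qed
  then show ?case
    by (intro exI conjI allI impI) (assumption | simp add: lucas_1)+
next
  case (Suc k)
  obtain er ea sr sa dab dra
    where prof: "\<And>(G :: 'a pair_pre_digraph) r a b. BT' k G r a b \<Longrightarrow> profile G r a b er ea sr sa dab dra"
    and vals: "real er = (lucas_V k + 5 * lucas_W k + 2) / 4"
      "real ea = (3 * lucas_V k + 11 * lucas_W k + 2) / 8"
      "real sr = 2 ^ k - 1"
      "real sa = (5 * lucas_V k + 21 * lucas_W k - 2) / 8 - 2 ^ k"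
    and vals': "real (dab + 2 * dra) = (5 * lucas_V (2 * k) + 21 * lucas_W (2 * k)) / 8
        + (5 * lucas_V k + 21 * lucas_W k) / 4 - 4 ^ k - 2 * 2 ^ k - 3 / 4"
    using Suc.IH by blast
  let ?er = "2 * ea" and ?ea = "er + 1 + sr + sa" and ?sr = "1 + 2 * sr" and ?sa = "ea + 2 * sa"
    and ?dab = "2 * (ea + 2 * sa + dra + 2 * (sa * sr) + sa * sa)"
    and ?dra = "ea + sr * ea + sa * ea + er * ea + dab + dra"
  have "profile G r a b ?er ?ea ?sr ?sa ?dab ?dra" if "BT' (Suc k) G r a b"
    for G :: "'a pair_pre_digraph" and r a b
    using that
  proof cases
    case base
    then show ?thesis using Suc.hyps by simp
  next
    case step
    show ?thesis
      unfolding step(1) by (rule profile_step[OF step(2-5) step(2,3)[THEN prof]])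
  qed
  moreover have "real (?dab + 2 * ?dra) = (5 * lucas_V (2 * Suc k) + 21 * lucas_W (2 * Suc k)) / 8
        + (5 * lucas_V (Suc k) + 21 * lucas_W (Suc k)) / 4 - 4 ^ Suc k - 2 * 2 ^ Suc k - 3 / 4"
  proof -
    have "real (?dab + 2 * ?dra) = 2 * real (dab + 2 * dra) + 4 * real ea + 4 * real sa
        + 4 * (real sa * real sr) + 2 * (real sa * real sa) + 2 * (real sr * real ea)
        + 2 * (real sa * real ea) + 2 * (real er * real ea)"
      by (simp add: algebra_simps)
    moreover have "(4::real) ^ k = 2 ^ k * 2 ^ k" by (simp flip: power_mult_distrib)
    ultimately show ?thesis
      unfolding vals vals' lucas_double lucas_Suc by (simp add: field_simps power2_eq_square)
  qed
  moreover have "real ?er = (lucas_V (Suc k) + 5 * lucas_W (Suc k) + 2) / 4"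
    "real ?ea = (3 * lucas_V (Suc k) + 11 * lucas_W (Suc k) + 2) / 8"
    "real ?sr = 2 ^ Suc k - 1"
    "real ?sa = (5 * lucas_V (Suc k) + 21 * lucas_W (Suc k) - 2) / 8 - 2 ^ Suc k"
    by (simp_all add: vals lucas_Suc field_simps)
  ultimately show ?case by blast
qed

text \<open>
  For $k = k' + 1$ the closed forms of $BT'_{k'}$ are inserted into the count. The products of two
  of them contribute $V_{k'}^2$ and $W_{k'}^2$ in the ratio $1:17$, so that only
  $V_{2k'} = (V_{k'}^2 + 17 W_{k'}^2)/2$ and $W_{2k'} = V_{k'} W_{k'}$ survive, and no $(-4)^{k'}$
  appears.
\<close>

lemma Ham_BT:
  fixes G :: "'a pair_pre_digraph"
  assumes "BT k G"
  shows "real (Ham (with_proj G)) = 3 / 16 * (17 * lucas_V (2 * k) + 71 * lucas_W (2 * k)) - 9 / 2 * 4 ^ k"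
    and "card (pverts G) = 3 * 2 ^ k - 2"
proof -
  consider "k = 1" "complete_digraph 4 (with_proj G)" | k' where "k = Suc k'" "k' \<ge> 1"
  proof (cases rule: BT.cases[OF assms])
    case (2 k' D r a b c M)
    have "k' \<ge> 1" using 2(3)[of 0] BT'_pos by simp
    then show ?thesis using that(2)[of k'] 2(1) by simp
  qed (use that in auto)
  then have "real (Ham (with_proj G)) = 3 / 16 * (17 * lucas_V (2 * k) + 71 * lucas_W (2 * k)) - 9 / 2 * 4 ^ k
    \<and> card (pverts G) = 3 * 2 ^ k - 2"
  proof cases
    case 1
    then show ?thesis using Ham_complete[of 4 G]
      by (simp add: lucas_1 complete_digraph_def fact_numeral)
  next
    case (2 k')
    obtain er ea sr sa dab dra
      where prof: "\<And>(G :: 'a pair_pre_digraph) r a b. BT' k' G r a b \<Longrightarrow> profile G r a b er ea sr sa dab dra"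
      and vals: "real er = (lucas_V k' + 5 * lucas_W k' + 2) / 4"
        "real ea = (3 * lucas_V k' + 11 * lucas_W k' + 2) / 8"
        "real sr = 2 ^ k' - 1"
        "real sa = (5 * lucas_V k' + 21 * lucas_W k' - 2) / 8 - 2 ^ k'"
      and vals': "real (dab + 2 * dra) = (5 * lucas_V (2 * k') + 21 * lucas_W (2 * k')) / 8
          + (5 * lucas_V k' + 21 * lucas_W k') / 4 - 4 ^ k' - 2 * 2 ^ k' - 3 / 4"
      using BT'_profile[where 'a = 'a, OF 2(2)] by blast
    note count = BT_profile_count[OF _ 2(2) prof, of G]
    have "real (Ham (with_proj G)) = 12 * (real ea + real sa) + 6 * (2 * real er * real ea + real (dab + 2 * dra)
        + 2 * (real sa + real sr) * real ea + 4 * real sa * real sr + 2 * real sa * real sa)"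
      using count(1) assms 2(1) by simp
    moreover have "(4::real) ^ k' = 2 ^ k' * 2 ^ k'" by (simp flip: power_mult_distrib)
    ultimately have "real (Ham (with_proj G)) = 3 / 16 * (17 * lucas_V (2 * k) + 71 * lucas_W (2 * k)) - 9 / 2 * 4 ^ k"
      unfolding vals vals' 2(1) lucas_double lucas_Suc by (simp add: field_simps power2_eq_square)
    then show ?thesis using count(2) assms 2(1) by simp
  qed
  then show "real (Ham (with_proj G)) = 3 / 16 * (17 * lucas_V (2 * k) + 71 * lucas_W (2 * k)) - 9 / 2 * 4 ^ k"
    "card (pverts G) = 3 * 2 ^ k - 2" by auto
qed

section \<open>The exponent of growth\<close>

lemma log_exponent_bounds: "\<bar>2 * log 2 ((1 + sqrt 17) / 2) - 2.714\<bar> < 0.0005"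
proof -
  let ?a = "(1 + sqrt 17) / 2 :: real"
  have s: "4.123 < sqrt (17::real)" "sqrt (17::real) < 4.1232"
    by (rule real_less_rsqrt, simp add: power2_eq_square, rule real_less_lsqrt, simp_all add: power2_eq_square)
  have sq: "?a ^ 2 = (9 + sqrt 17) / 2" by (simp add: power2_eq_square field_simps)
  have a: "?a > 0" using s by simp
  (* 502/185 = 2.71351... and 19/7 = 2.71428... enclose the exponent within the required bounds *)
  have lo: "(2::real) ^ 502 < (?a ^ 2) ^ 185"
  proof -
    (* 12161 is just below 6.5615^5, and 185 = 5 * 37; this keeps the numerals small *)
    have "(2::real) ^ 502 < 12161 ^ 37" by simp
    also have "(12161::real) ^ 37 \<le> (6.5615 ^ 5) ^ 37" by (intro power_mono) (simp_all add: field_simps)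
    also have "\<dots> = 6.5615 ^ 185" by (simp only: flip: power_mult) simp
    also have "\<dots> \<le> (?a ^ 2) ^ 185" using s sq by (intro power_mono) auto
    finally show ?thesis .
  qed
  have hi: "(?a ^ 2) ^ 7 < (2::real) ^ 19"
  proof -
    have "(?a ^ 2) ^ 7 \<le> 6.5616 ^ 7" using s sq by (intro power_mono) auto
    also have "\<dots> < (2::real) ^ 19" by (simp add: field_simps)
    finally show ?thesis .
  qed
  have "502 < 185 * log 2 (?a ^ 2)"
  proof -
    have "log 2 ((2::real) ^ 502) < log 2 ((?a ^ 2) ^ 185)"
      using lo a by (subst log_less_cancel_iff) auto
    then show ?thesis using a by (subst (asm) (1 2) log_nat_power) auto
  qed
  moreover have "7 * log 2 (?a ^ 2) < 19"
  proof -
    have "log 2 ((?a ^ 2) ^ 7) < log 2 ((2::real) ^ 19)"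
      using hi a by (subst log_less_cancel_iff) auto
    then show ?thesis using a by (subst (asm) (1 2) log_nat_power) auto
  qed
  moreover have "log 2 (?a ^ 2) = 2 * log 2 ?a"
    using a by (simp add: log_nat_power)
  ultimately show ?thesis by (simp add: abs_if)
qed

text \<open>
  With $\theta = \log_2 (x^2)$ the function $x^{2k}$ equals $(2^k)^\theta$, and the number
  $3 \cdot 2^k - 2$ lies between $2^k$ and $3 \cdot 2^k$.
\<close>

lemma growth_bigtheta:
  fixes x P :: real
  assumes "x > 1" "P > 0"
  shows "(\<lambda>k. P * x ^ (2 * k)) \<in> \<Theta>(\<lambda>k. real (3 * 2 ^ k - 2) powr log 2 (x\<^sup>2))"
proof -
  let ?\<theta> = "log 2 (x\<^sup>2)"
  have th: "?\<theta> \<ge> 0" using assms(1) by simp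
  have pow: "(2 ^ k) powr ?\<theta> = x ^ (2 * k)" for k :: nat
  proof -
    have "(2 ^ k) powr ?\<theta> = (2 powr ?\<theta>) ^ k"
      by (simp add: powr_powr powr_realpow[symmetric] mult.commute)
    then show ?thesis using assms(1) by (simp add: power_mult)
  qed
  have lo: "x ^ (2 * k) \<le> real (3 * 2 ^ k - 2) powr ?\<theta>" for k
  proof -
    have "(1::nat) \<le> 2 ^ k" by simp
    then have "(2::nat) ^ k \<le> 3 * 2 ^ k - 2" by linarith
    then have "(2::real) ^ k \<le> real (3 * 2 ^ k - 2)"
      by (metis of_nat_le_iff of_nat_numeral of_nat_power)
    then show ?thesis unfolding pow[symmetric] using th by (intro powr_mono2) auto
  qed
  have hi: "real (3 * 2 ^ k - 2) powr ?\<theta> \<le> 3 powr ?\<theta> * x ^ (2 * k)" for k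
  proof -
    have "real (3 * 2 ^ k - 2) \<le> real (3 * 2 ^ k)" by (rule of_nat_mono) simp
    then have "real (3 * 2 ^ k - 2) powr ?\<theta> \<le> (3 * 2 ^ k) powr ?\<theta>"
      using th by (intro powr_mono2) auto
    then show ?thesis by (simp add: powr_mult pow)
  qed
  have "(\<lambda>k. P * x ^ (2 * k)) \<in> O(\<lambda>k. real (3 * 2 ^ k - 2) powr ?\<theta>)"
    using lo assms by (intro bigoI[of _ P]) (auto intro!: always_eventually mult_left_mono)
  moreover have "(\<lambda>k. real (3 * 2 ^ k - 2) powr ?\<theta>) \<in> O(\<lambda>k. P * x ^ (2 * k))"
  proof (intro bigoI[of _ "3 powr ?\<theta> / P"] always_eventually allI)
    fix k
    show "norm (real (3 * 2 ^ k - 2) powr ?\<theta>) \<le> 3 powr ?\<theta> / P * norm (P * x ^ (2 * k))"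
      using hi[of k] assms by (simp add: abs_mult)
  qed
  ultimately show ?thesis by (simp add: bigthetaI bigomega_iff_bigo)
qed

section \<open>The number of Hamiltonian paths\<close>

theorem theorem2:
  fixes \<alpha> \<beta> P Q \<theta> :: real and V W :: "nat \<Rightarrow> int"
  assumes "\<alpha> = (1 + sqrt 17) / 2" and "\<beta> = (1 - sqrt 17) / 2"
    and "V 0 = 2" and "V 1 = 1" and "\<And>j. j \<ge> 1 \<Longrightarrow> V (j + 1) = V j + 4 * V (j - 1)"
    and "W 0 = 0" and "W 1 = 1" and "\<And>j. j \<ge> 1 \<Longrightarrow> W (j + 1) = W j + 4 * W (j - 1)"
    and "P = (867 + 213 * sqrt 17) / 272" and "Q = (867 - 213 * sqrt 17) / 272"
    and "\<theta> = log 2 (\<alpha>\<^sup>2)"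
  shows "{x::real. x\<^sup>2 - x - 4 = 0} = {\<alpha>, \<beta>} \<and>
    (\<forall>j. real_of_int (V j) = \<alpha> ^ j + \<beta> ^ j) \<and>
    (\<forall>j. real_of_int (W j) = (\<alpha> ^ j - \<beta> ^ j) / sqrt 17) \<and>
    (\<forall>k\<ge>1. \<forall>G :: 'a pair_pre_digraph. BT k G \<longrightarrow>
      real (Ham (with_proj G)) =
        3 / 16 * (17 * real_of_int (V (2 * k)) + 71 * real_of_int (W (2 * k))) - 9 / 2 * 4 ^ k) \<and>
    (\<forall>k\<ge>1. \<forall>G :: 'a pair_pre_digraph. BT k G \<longrightarrow>
      real (Ham (with_proj G)) = P * \<alpha> ^ (2 * k) + Q * \<beta> ^ (2 * k) - 9 / 2 * 4 ^ k) \<and>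
    (\<forall>k\<ge>1. \<forall>G :: 'a pair_pre_digraph. BT k G \<longrightarrow> card (pverts G) = 3 * 2 ^ k - 2) \<and>
    \<theta> = 2 * log 2 \<alpha> \<and>
    \<bar>\<theta> - 2.714\<bar> < 0.0005 \<and>
    (\<lambda>k. P * \<alpha> ^ (2 * k)) \<in> \<Theta>(\<lambda>k. real (3 * 2 ^ k - 2) powr \<theta>)"
proof -
  let ?s = "sqrt 17 :: real"
  have ss: "?s * ?s = 17" by simp
  have V: "real_of_int (V j) = lucas_V j" for j
    by (rule recurrence_unique) (use assms(3-5) lucas_0 lucas_1 lucas_Suc_Suc in auto)
  have W: "real_of_int (W j) = lucas_W j" for j
    by (rule recurrence_unique) (use assms(6-8) lucas_0 lucas_1 lucas_Suc_Suc in auto)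
  have PQ: "P * \<alpha> ^ (2 * k) + Q * \<beta> ^ (2 * k) = 3 / 16 * (17 * lucas_V (2 * k) + 71 * lucas_W (2 * k))" for k
  proof -
    have "z / ?s = ?s * z / 17" for z
    proof -
      have "?s * z / 17 = ?s * z / (?s * ?s)" by (simp only: ss)
      also have "\<dots> = z / ?s" by (rule nonzero_mult_divide_mult_cancel_left) simp
      finally show ?thesis by simp
    qed
    then have W2: "lucas_W (2 * k) = ?s * (\<alpha> ^ (2 * k) - \<beta> ^ (2 * k)) / 17"
      by (simp only: lucas_W_def assms(1,2))
    have V2: "lucas_V (2 * k) = \<alpha> ^ (2 * k) + \<beta> ^ (2 * k)"
      by (simp only: lucas_V_def assms(1,2))
    show ?thesis
      unfolding V2 W2 assms(9,10) by (simp add: field_simps)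
  qed
  have "x\<^sup>2 - x - 4 = (x - \<alpha>) * (x - \<beta>)" for x
    using ss by (simp add: assms(1,2) field_simps power2_eq_square)
  then have roots: "{x::real. x\<^sup>2 - x - 4 = 0} = {\<alpha>, \<beta>}" by auto
  have "?s > 1" by simp
  then have \<alpha>: "\<alpha> > 1" by (simp add: assms(1))
  have P: "P > 0" unfolding assms(9) by (intro divide_pos_pos add_pos_pos) simp_all
  have \<theta>: "\<theta> = 2 * log 2 \<alpha>" using \<alpha> by (simp add: assms(11) log_nat_power)
  show ?thesis
  proof (intro conjI allI impI)
    show "{x::real. x\<^sup>2 - x - 4 = 0} = {\<alpha>, \<beta>}" by (fact roots)
    show "real_of_int (V j) = \<alpha> ^ j + \<beta> ^ j" for j by (simp add: V lucas_V_def assms(1,2))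
    show "real_of_int (W j) = (\<alpha> ^ j - \<beta> ^ j) / sqrt 17" for j by (simp add: W lucas_W_def assms(1,2))
    show "real (Ham (with_proj G)) =
        3 / 16 * (17 * real_of_int (V (2 * k)) + 71 * real_of_int (W (2 * k))) - 9 / 2 * 4 ^ k"
      if "BT k G" for k and G :: "'a pair_pre_digraph"
      unfolding V W by (rule Ham_BT(1)[OF that])
    show "real (Ham (with_proj G)) = P * \<alpha> ^ (2 * k) + Q * \<beta> ^ (2 * k) - 9 / 2 * 4 ^ k"
      if "BT k G" for k and G :: "'a pair_pre_digraph"
      unfolding PQ by (rule Ham_BT(1)[OF that])
    show "card (pverts G) = 3 * 2 ^ k - 2" if "BT k G" for k and G :: "'a pair_pre_digraph"
      by (rule Ham_BT(2)[OF that])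
    show "\<theta> = 2 * log 2 \<alpha>" by (fact \<theta>)
    show "\<bar>\<theta> - 2.714\<bar> < 0.0005" unfolding \<theta> assms(1) by (rule log_exponent_bounds)
    show "(\<lambda>k. P * \<alpha> ^ (2 * k)) \<in> \<Theta>(\<lambda>k. real (3 * 2 ^ k - 2) powr \<theta>)"
      unfolding assms(11) by (rule growth_bigtheta[OF \<alpha> P])
  qed
qed

end
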